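(* Let $\mathbf{NQP}$, resp. $\mathbf{AQP}$, resp. $\mathbf{CP}$ be the full subcategory of $\mathbf{QP}$ consisting of those pairs of groups $(G,B)$ for which $B$ is normal in $G$, resp. abelian, resp. central in $G$ and containing $G'$. (a) There are functors $$Gr\colon\mathbf{QP}\to\mathbf{Ab}\times\mathbf{Gr},\quad Gr_N\colon\mathbf{NQP}\to\mathbf{Gr}\times\mathbf{Gr},\quad Gr_A\colon\mathbf{AQP}\to\mathbf{Ab}\times\mathbf{Ab},\quad Gr_C\colon\mathbf{CP}\to\mathbf{Ab}\times\mathbf{Ab}$$ such that $Gr$ and $Gr_A$ send an object $(G,B)$ to $(G/G'B,\,B)$, while $Gr_N$ and $Gr_C$ send $(G,B)$ to $(G/B,\,B)$, and all of them send a morphism $f\colon(G,B)\to(H,C)$ to $(\bar f,f_B)$, where $f_B\colon B\to C$ is the restriction of $f$ and $\bar f$ is the map on quotients induced by $f$. (b) There is a bifunctor $D\colon\mathbf{AQP}^{op}\times\mathbf{AQP}\to\mathbf{Ab}$ defined by $$D((G,B),(H,C))=\mathrm{Hom}\big((G/G'B)\otimes(G/G'B),\,C\big)\quad\text{and}\quad D(g^{op},f)=f_*(\bar g\otimes\bar g)^*,$$ i.e. $D(g^{op},f)$ sends $u$ to $f_C\circ u\circ(\bar g\otimes\bar g)$ for morphisms $g\colon(G_1,B_1)\to(G,B)$ and $f\colon(H,C)\to(H_1,C_1)$ of $\mathbf{AQP}$, where $f_C\colon C\to C_1$ is the restriction of $f$ and $\bar g\colon G_1/G_1'B_1\to G/G'B$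 is induced by $g$. (c) Assigning to a morphism $f\colon(G,B)\to(H,C)$ in $\mathbf{AQP}$ the element $w_f\in D((G,B),(H,C))$ defines a derivation from $\mathbf{AQP}$ to $D$; that is, for all composable morphisms $g\colon(K,A)\to(G,B)$ and $f\colon(G,B)\to(H,C)$ of $\mathbf{AQP}$, $$w_{fg}=D(\mathrm{id}^{op},f)(w_g)+D(g^{op},\mathrm{id})(w_f).$$
   Context: For a function $f\colon G\to H$ between arbitrary groups, with the target written additively (though not necessarily abelian), put $d_f(a,b)=f(ab)-f(b)-f(a)$, and let $D_f$ be the subgroup of $H$ generated by the image of $d_f$. The map $f$ is quadratic if $d_f$ is bilinear (a homomorphism in each variable) and $d_f(a,b)$ commutes with $f(c)$ for all $a,b,c\in G$. For a subgroup $B\le G$, $f$ is quadratic relative $B$ if $f$ is quadratic and $d_f(B\times G)=d_f(G\times B)=0$; in that case $w_f\colon G/G'B\otimes G/G'B\to H$ denotes the homomorphism with $w_f(\bar a\otimes\bar b)=d_f(a,b)$, where $G'=[G,G]$. $\mathbf{QP}$ is the category whose objects are pairs $(G,B)$ of a group $G$ and a subgroup $B$ of $G$, and whose morphisms $(G,B)\to(H,C)$ are the quadratic pair maps: functions $f\colon G\to H$ with $f(B)\subset C$ such that $f$ is quadratic relative $B$ and $D_f\subset C$. For such $f$, $w_f$ takes values in $C$ and is regarded as a map to $C$. $\mathbf{Gr}$ and $\mathbf{Ab}$ are the categories of groups and of abelian groups (with homomorphisms). *)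

theory Defs
  imports "HOL-Algebra.Free_Abelian_Groups" "HOL-Algebra.Generated_Groups"
begin

section \<open>Categories and functors\<close>

text \<open>Hom-sets, identities and composition are indexed by their objects, so that hom-sets
  need not be disjoint. \<open>Comp C X Y Z g f\<close> is \<open>g\<close> after \<open>f\<close>, for \<open>f : X \<rightarrow> Y\<close> and
  \<open>g : Y \<rightarrow> Z\<close>.\<close>

record ('o, 'm) category =
  Obj :: "'o set"
  Mor :: "'o \<Rightarrow> 'o \<Rightarrow> 'm set"
  Ident :: "'o \<Rightarrow> 'm"
  Comp :: "'o \<Rightarrow> 'o \<Rightarrow> 'o \<Rightarrow> 'm \<Rightarrow> 'm \<Rightarrow> 'm"

locale category =
  fixes C :: "('o, 'm) category"
  assumes ident_mor: "X \<in> Obj C \<Longrightarrow> Ident C X \<in> Mor C X X"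
    and comp_mor: "\<lbrakk>X \<in> Obj C; Y \<in> Obj C; Z \<in> Obj C; f \<in> Mor C X Y; g \<in> Mor C Y Z\<rbrakk>
      \<Longrightarrow> Comp C X Y Z g f \<in> Mor C X Z"
    and comp_ident_right: "\<lbrakk>X \<in> Obj C; Y \<in> Obj C; f \<in> Mor C X Y\<rbrakk>
      \<Longrightarrow> Comp C X X Y f (Ident C X) = f"
    and comp_ident_left: "\<lbrakk>X \<in> Obj C; Y \<in> Obj C; f \<in> Mor C X Y\<rbrakk>
      \<Longrightarrow> Comp C X Y Y (Ident C Y) f = f"
    and comp_assoc: "\<lbrakk>W \<in> Obj C; X \<in> Obj C; Y \<in> Obj C; Z \<in> Obj C;
        f \<in> Mor C W X; g \<in> Mor C X Y; h \<in> Mor C Y Z\<rbrakk>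
      \<Longrightarrow> Comp C W X Z (Comp C X Y Z h g) f = Comp C W Y Z h (Comp C W X Y g f)"

record ('o, 'm, 'p, 'n) functor_data =
  fobj :: "'o \<Rightarrow> 'p"
  fmor :: "'o \<Rightarrow> 'o \<Rightarrow> 'm \<Rightarrow> 'n"

locale is_functor = source: category C + target: category D
  for C :: "('o, 'm) category" and D :: "('p, 'n) category" +
  fixes F :: "('o, 'm, 'p, 'n) functor_data"
  assumes fobj_closed: "X \<in> Obj C \<Longrightarrow> fobj F X \<in> Obj D"
    and fmor_closed: "\<lbrakk>X \<in> Obj C; Y \<in> Obj C; f \<in> Mor C X Y\<rbrakk>
      \<Longrightarrow> fmor F X Y f \<in> Mor D (fobj F X) (fobj F Y)"
    and fmor_ident: "X \<in> Obj C \<Longrightarrow> fmor F X X (Ident C X) = Ident D (fobj F X)"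
    and fmor_comp: "\<lbrakk>X \<in> Obj C; Y \<in> Obj C; Z \<in> Obj C; f \<in> Mor C X Y; g \<in> Mor C Y Z\<rbrakk>
      \<Longrightarrow> fmor F X Z (Comp C X Y Z g f)
        = Comp D (fobj F X) (fobj F Y) (fobj F Z) (fmor F Y Z g) (fmor F X Y f)"

definition op_cat :: "('o, 'm) category \<Rightarrow> ('o, 'm) category" where
  "op_cat C = \<lparr>Obj = Obj C, Mor = (\<lambda>X Y. Mor C Y X), Ident = Ident C,
     Comp = (\<lambda>X Y Z g f. Comp C Z Y X f g)\<rparr>"

definition prod_cat :: "('o, 'm) category \<Rightarrow> ('p, 'n) category \<Rightarrow> ('o \<times> 'p, 'm \<times> 'n) category"
    (infixr "\<times>\<^sub>C" 80) where
  "C \<times>\<^sub>C D = \<lparr>Obj = Obj C \<times> Obj D,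
     Mor = (\<lambda>X Y. Mor C (fst X) (fst Y) \<times> Mor D (snd X) (snd Y)),
     Ident = (\<lambda>X. (Ident C (fst X), Ident D (snd X))),
     Comp = (\<lambda>X Y Z g f. (Comp C (fst X) (fst Y) (fst Z) (fst g) (fst f),
                          Comp D (snd X) (snd Y) (snd Z) (snd g) (snd f)))\<rparr>"

definition full_subcat :: "('o, 'm) category \<Rightarrow> ('o \<Rightarrow> bool) \<Rightarrow> ('o, 'm) category" where
  "full_subcat C P = C\<lparr>Obj := {X \<in> Obj C. P X}\<rparr>"


section \<open>Groups with carrier in a fixed type\<close>

text \<open>Morphisms are extensional functions (undefined off the carrier of the source), so that
  equality of morphisms is equality on the carrier.\<close>

definition ext_hom :: "'a monoid \<Rightarrow> 'b monoid \<Rightarrow> ('a \<Rightarrow> 'b) set" where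
  "ext_hom G H = hom G H \<inter> extensional (carrier G)"

definition Grp :: "('a monoid, 'a \<Rightarrow> 'a) category" where
  "Grp = \<lparr>Obj = {G. group G}, Mor = ext_hom, Ident = (\<lambda>G. \<lambda>x\<in>carrier G. x),
     Comp = (\<lambda>G H K g f. compose (carrier G) g f)\<rparr>"

definition Ab :: "('a monoid, 'a \<Rightarrow> 'a) category" where
  "Ab = full_subcat Grp comm_group"

text \<open>The map \<open>G/N \<rightarrow> H/M\<close> induced by \<open>f\<close>: the coset of \<open>x\<close> goes to the coset of \<open>f x\<close>.
  It is meaningful only if that coset does not depend on the representative \<open>x\<close>.\<close>

definition quot_map :: "'a monoid \<Rightarrow> 'a set \<Rightarrow> 'b monoid \<Rightarrow> 'b set \<Rightarrow> ('a \<Rightarrow> 'b) \<Rightarrow> 'a set \<Rightarrow> 'b set" where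
  "quot_map G N H M f =
     (\<lambda>X\<in>carrier (G Mod N). the_elem ((\<lambda>x. M #>\<^bsub>H\<^esub> f x) ` X))"


section \<open>Tensor products and Hom groups of abelian groups\<close>

definition tensor_rel :: "'a monoid \<Rightarrow> 'b monoid \<Rightarrow> ('a \<times> 'b \<Rightarrow>\<^sub>0 int) set" where
  "tensor_rel A B = generate (free_Abelian_group (carrier A \<times> carrier B))
     ({frag_of (a \<otimes>\<^bsub>A\<^esub> a', b) - frag_of (a, b) - frag_of (a', b) | a a' b.
         a \<in> carrier A \<and> a' \<in> carrier A \<and> b \<in> carrier B} \<union>
      {frag_of (a, b \<otimes>\<^bsub>B\<^esub> b') - frag_of (a, b) - frag_of (a, b') | a b b'.
         a \<in> carrier A \<and> b \<in> carrier B \<and> b' \<in> carrier B})"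

definition tensor :: "'a monoid \<Rightarrow> 'b monoid \<Rightarrow> ('a \<times> 'b \<Rightarrow>\<^sub>0 int) set monoid" where
  "tensor A B = free_Abelian_group (carrier A \<times> carrier B) Mod tensor_rel A B"

definition pure_tensor :: "'a monoid \<Rightarrow> 'b monoid \<Rightarrow> 'a \<Rightarrow> 'b \<Rightarrow> ('a \<times> 'b \<Rightarrow>\<^sub>0 int) set" where
  "pure_tensor A B a b =
     tensor_rel A B #>\<^bsub>free_Abelian_group (carrier A \<times> carrier B)\<^esub> frag_of (a, b)"

text \<open>\<open>h \<otimes> k : A \<otimes> B \<rightarrow> A' \<otimes> B'\<close>, induced by \<open>(a, b) \<mapsto> (h a, k b)\<close> on the generators of the
  free abelian groups.\<close>

definition tensor_map ::
  "'a monoid \<Rightarrow> 'b monoid \<Rightarrow> 'c monoid \<Rightarrow> 'd monoid \<Rightarrow> ('a \<Rightarrow> 'c) \<Rightarrow> ('b \<Rightarrow> 'd)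
    \<Rightarrow> ('a \<times> 'b \<Rightarrow>\<^sub>0 int) set \<Rightarrow> ('c \<times> 'd \<Rightarrow>\<^sub>0 int) set" where
  "tensor_map A B A' B' h k =
     quot_map (free_Abelian_group (carrier A \<times> carrier B)) (tensor_rel A B)
              (free_Abelian_group (carrier A' \<times> carrier B')) (tensor_rel A' B')
              (frag_extend (\<lambda>(a, b). frag_of (h a, k b)))"

definition hom_group :: "'a monoid \<Rightarrow> 'b monoid \<Rightarrow> ('a \<Rightarrow> 'b) monoid" where
  "hom_group A C = \<lparr>carrier = ext_hom A C,
     mult = (\<lambda>u v. \<lambda>x\<in>carrier A. u x \<otimes>\<^bsub>C\<^esub> v x),
     one = (\<lambda>x\<in>carrier A. \<one>\<^bsub>C\<^esub>)\<rparr>"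


section \<open>Quadratic maps and pairs of groups\<close>

text \<open>\<open>d\<^sub>f(a,b) = f(ab) - f(b) - f(a)\<close>, in this order, as the target need not be abelian.\<close>

definition dev :: "'a monoid \<Rightarrow> 'b monoid \<Rightarrow> ('a \<Rightarrow> 'b) \<Rightarrow> 'a \<Rightarrow> 'a \<Rightarrow> 'b" where
  "dev G H f a b = f (a \<otimes>\<^bsub>G\<^esub> b) \<otimes>\<^bsub>H\<^esub> inv\<^bsub>H\<^esub> (f b) \<otimes>\<^bsub>H\<^esub> inv\<^bsub>H\<^esub> (f a)"

definition dev_subgroup :: "'a monoid \<Rightarrow> 'b monoid \<Rightarrow> ('a \<Rightarrow> 'b) \<Rightarrow> 'b set" where
  "dev_subgroup G H f = generate H {dev G H f a b | a b. a \<in> carrier G \<and> b \<in> carrier G}"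

definition quadratic :: "'a monoid \<Rightarrow> 'b monoid \<Rightarrow> ('a \<Rightarrow> 'b) \<Rightarrow> bool" where
  "quadratic G H f \<longleftrightarrow> f \<in> carrier G \<rightarrow> carrier H \<and>
     (\<forall>b\<in>carrier G. (\<lambda>a. dev G H f a b) \<in> hom G H) \<and>
     (\<forall>a\<in>carrier G. (\<lambda>b. dev G H f a b) \<in> hom G H) \<and>
     (\<forall>a\<in>carrier G. \<forall>b\<in>carrier G. \<forall>c\<in>carrier G.
        dev G H f a b \<otimes>\<^bsub>H\<^esub> f c = f c \<otimes>\<^bsub>H\<^esub> dev G H f a b)"

definition quadratic_rel :: "'a monoid \<Rightarrow> 'a set \<Rightarrow> 'b monoid \<Rightarrow> ('a \<Rightarrow> 'b) \<Rightarrow> bool" where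
  "quadratic_rel G B H f \<longleftrightarrow> quadratic G H f \<and>
     (\<forall>b\<in>B. \<forall>a\<in>carrier G. dev G H f b a = \<one>\<^bsub>H\<^esub> \<and> dev G H f a b = \<one>\<^bsub>H\<^esub>)"

type_synonym 'a gpair = "'a monoid \<times> 'a set"

definition QP :: "('a gpair, 'a \<Rightarrow> 'a) category" where
  "QP = \<lparr>Obj = {(G, B). group G \<and> subgroup B G},
     Mor = (\<lambda>(G, B) (H, C). {f \<in> carrier G \<rightarrow>\<^sub>E carrier H.
        f ` B \<subseteq> C \<and> quadratic_rel G B H f \<and> dev_subgroup G H f \<subseteq> C}),
     Ident = (\<lambda>(G, B). \<lambda>x\<in>carrier G. x),
     Comp = (\<lambda>(G, B) _ _ g f. compose (carrier G) g f)\<rparr>"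

definition NQP :: "('a gpair, 'a \<Rightarrow> 'a) category" where
  "NQP = full_subcat QP (\<lambda>(G, B). B \<lhd> G)"

definition AQP :: "('a gpair, 'a \<Rightarrow> 'a) category" where
  "AQP = full_subcat QP (\<lambda>(G, B). comm_group (G\<lparr>carrier := B\<rparr>))"

definition CP :: "('a gpair, 'a \<Rightarrow> 'a) category" where
  "CP = full_subcat QP (\<lambda>(G, B).
     (\<forall>b\<in>B. \<forall>x\<in>carrier G. b \<otimes>\<^bsub>G\<^esub> x = x \<otimes>\<^bsub>G\<^esub> b) \<and> derived G (carrier G) \<subseteq> B)"

text \<open>The subgroup \<open>G'B\<close> of \<open>G\<close> and the group \<open>G/G'B\<close>.\<close>

definition derived_mult :: "'a gpair \<Rightarrow> 'a set" where
  "derived_mult = (\<lambda>(G, B). derived G (carrier G) <#>\<^bsub>G\<^esub> B)"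

definition ab_quot :: "'a gpair \<Rightarrow> 'a set monoid" where
  "ab_quot X = fst X Mod derived_mult X"

text \<open>The map \<open>G/G'B \<rightarrow> H/H'C\<close> induced by \<open>f\<close>.\<close>

definition ab_quot_map :: "'a gpair \<Rightarrow> 'a gpair \<Rightarrow> ('a \<Rightarrow> 'a) \<Rightarrow> 'a set \<Rightarrow> 'a set" where
  "ab_quot_map X Y f = quot_map (fst X) (derived_mult X) (fst Y) (derived_mult Y) f"

text \<open>\<open>(G, B) \<mapsto> (G/G'B, B)\<close>; underlies both \<open>Gr\<close> and \<open>Gr\<^sub>A\<close>.\<close>

definition Gr_ab ::
  "('a gpair, 'a \<Rightarrow> 'a, 'a set monoid \<times> 'a monoid, ('a set \<Rightarrow> 'a set) \<times> ('a \<Rightarrow> 'a)) functor_data" where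
  "Gr_ab = \<lparr>fobj = (\<lambda>(G, B). (ab_quot (G, B), G\<lparr>carrier := B\<rparr>)),
     fmor = (\<lambda>(G, B) (H, C) f. (ab_quot_map (G, B) (H, C) f, restrict f B))\<rparr>"

text \<open>\<open>(G, B) \<mapsto> (G/B, B)\<close>; underlies both \<open>Gr\<^sub>N\<close> and \<open>Gr\<^sub>C\<close>.\<close>

definition Gr_normal ::
  "('a gpair, 'a \<Rightarrow> 'a, 'a set monoid \<times> 'a monoid, ('a set \<Rightarrow> 'a set) \<times> ('a \<Rightarrow> 'a)) functor_data" where
  "Gr_normal = \<lparr>fobj = (\<lambda>(G, B). (G Mod B, G\<lparr>carrier := B\<rparr>)),
     fmor = (\<lambda>(G, B) (H, C) f. (quot_map G B H C f, restrict f B))\<rparr>"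

definition tensor_sq :: "'a gpair \<Rightarrow> ('a set \<times> 'a set \<Rightarrow>\<^sub>0 int) set monoid" where
  "tensor_sq X = tensor (ab_quot X) (ab_quot X)"

definition tensor_sq_map ::
  "'a gpair \<Rightarrow> 'a gpair \<Rightarrow> ('a \<Rightarrow> 'a)
    \<Rightarrow> ('a set \<times> 'a set \<Rightarrow>\<^sub>0 int) set \<Rightarrow> ('a set \<times> 'a set \<Rightarrow>\<^sub>0 int) set" where
  "tensor_sq_map X Y g =
     tensor_map (ab_quot X) (ab_quot X) (ab_quot Y) (ab_quot Y) (ab_quot_map X Y g) (ab_quot_map X Y g)"

text \<open>The class of \<open>a \<otimes> b\<close> in \<open>G/G'B \<otimes> G/G'B\<close>, for \<open>a, b\<close> in \<open>G\<close>.\<close>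

definition class_tensor :: "'a gpair \<Rightarrow> 'a \<Rightarrow> 'a \<Rightarrow> ('a set \<times> 'a set \<Rightarrow>\<^sub>0 int) set" where
  "class_tensor X a b = pure_tensor (ab_quot X) (ab_quot X)
     (derived_mult X #>\<^bsub>fst X\<^esub> a) (derived_mult X #>\<^bsub>fst X\<^esub> b)"

text \<open>\<open>w\<^sub>f\<close> for \<open>f\<close> quadratic relative \<open>B\<close> from the pair \<open>X = (G, B)\<close> to the group \<open>H\<close>.\<close>

definition w_map ::
  "'a gpair \<Rightarrow> 'b monoid \<Rightarrow> ('a \<Rightarrow> 'b) \<Rightarrow> ('a set \<times> 'a set \<Rightarrow>\<^sub>0 int) set \<Rightarrow> 'b" where
  "w_map X H f = (THE w. w \<in> ext_hom (tensor_sq X) H \<and>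
     (\<forall>a\<in>carrier (fst X). \<forall>b\<in>carrier (fst X). w (class_tensor X a b) = dev (fst X) H f a b))"

definition Dbifun ::
  "('a gpair \<times> 'a gpair, ('a \<Rightarrow> 'a) \<times> ('a \<Rightarrow> 'a),
    (('a set \<times> 'a set \<Rightarrow>\<^sub>0 int) set \<Rightarrow> 'a) monoid,
    (('a set \<times> 'a set \<Rightarrow>\<^sub>0 int) set \<Rightarrow> 'a) \<Rightarrow> (('a set \<times> 'a set \<Rightarrow>\<^sub>0 int) set \<Rightarrow> 'a)) functor_data" where
  "Dbifun = \<lparr>fobj = (\<lambda>(X, (H, C)). hom_group (tensor_sq X) (H\<lparr>carrier := C\<rparr>)),
     fmor = (\<lambda>(X, (H, C)) (X\<^sub>1, (H\<^sub>1, C\<^sub>1)) (g, f).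
       \<lambda>u\<in>carrier (hom_group (tensor_sq X) (H\<lparr>carrier := C\<rparr>)).
         compose (carrier (tensor_sq X\<^sub>1)) (restrict f C)
           (compose (carrier (tensor_sq X\<^sub>1)) u (tensor_sq_map X\<^sub>1 X g)))\<rparr>"

end

theory Submission
  imports Defs "HOL-Algebra.Zassenhaus"
begin

text \<open>The statement rests on two facts about a quadratic pair map \<open>f : (G, B) \<rightarrow> (H, C)\<close>.
  By definition \<open>f (x y) = d\<^sub>f(x, y) f x f y\<close> (lemma \<open>map_mult\<close>), where the deviation
  \<open>d\<^sub>f(x, y)\<close> lies in \<open>C\<close>.

  Firstly, \<open>f\<close> is a homomorphism on \<open>B\<close>, where \<open>d\<^sub>f\<close> vanishes, and is multiplicative modulo
  every normal subgroup of \<open>H\<close> that contains \<open>C\<close> (lemma \<open>hom_modulo_normal\<close>). So it induces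
  homomorphisms \<open>G/B \<rightarrow> H/C\<close> in the normal case and \<open>G/G'B \<rightarrow> H/H'C\<close> in general, since a
  homomorphism into an abelian group that kills \<open>B\<close> kills \<open>G'B\<close>. This gives all the functors
  of the first part. If \<open>C\<close> is abelian, the same principle applied to \<open>d\<^sub>f\<close> in each variable
  shows that \<open>d\<^sub>f\<close> descends to a bilinear map on \<open>G/G'B\<close>, and the universal property of
  the tensor product (lemma \<open>tensor_universal\<close>) yields \<open>w\<^sub>f\<close>.

  Secondly, for \<open>g\<close> followed by \<open>f\<close> there is the chain rule
  \<open>d\<^sub>f\<^sub>g(a, b) = f(d\<^sub>g(a, b)) d\<^sub>f(g a, g b)\<close> (lemma \<open>dev_compose\<close>). It shows that
  quadratic pair maps are closed under composition. It is also the derivation property evaluated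
  on the class of \<open>a \<otimes> b\<close>, and homomorphisms on a tensor product are determined by their
  values on pure tensors (lemma \<open>tensor_hom_eqI\<close>). That \<open>D\<close> is a bifunctor is
  functoriality of the tensor product together with additivity of \<open>f\<close> on \<open>C\<close>.\<close>


section \<open>Maps between quotient groups\<close>

text \<open>\<open>f\<close> sends \<open>N\<close> into \<open>M\<close> and is multiplicative modulo \<open>M\<close>. This makes
  \<^const>\<open>quot_map\<close> a well-defined homomorphism \<open>G/N \<rightarrow> H/M\<close>, although \<open>f\<close> itself
  need not be a homomorphism.\<close>

definition hom_modulo :: "'a monoid \<Rightarrow> 'a set \<Rightarrow> 'b monoid \<Rightarrow> 'b set \<Rightarrow> ('a \<Rightarrow> 'b) \<Rightarrow> bool" where
  "hom_modulo G N H M f \<longleftrightarrow> f \<in> carrier G \<rightarrow> carrier H \<and> f ` N \<subseteq> M \<and>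
     (\<forall>x\<in>carrier G. \<forall>y\<in>carrier G. M #>\<^bsub>H\<^esub> f (x \<otimes>\<^bsub>G\<^esub> y) = M #>\<^bsub>H\<^esub> (f x \<otimes>\<^bsub>H\<^esub> f y))"

lemma hom_imp_hom_modulo:
  assumes "f \<in> hom G H" "f ` N \<subseteq> M"
  shows "hom_modulo G N H M f"
  using assms by (auto simp: hom_modulo_def hom_def Pi_iff)

lemma hom_modulo_coset_const:
  assumes N: "N \<lhd> G" and M: "M \<lhd> H" and f: "hom_modulo G N H M f"
    and x: "x \<in> carrier G" and y: "y \<in> N #>\<^bsub>G\<^esub> x"
  shows "M #>\<^bsub>H\<^esub> f y = M #>\<^bsub>H\<^esub> f x"
proof -
  interpret N: normal N G by (rule N)
  interpret M: normal M H by (rule M)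
  obtain n where n: "n \<in> N" "y = n \<otimes>\<^bsub>G\<^esub> x"
    using y by (auto simp: r_coset_def)
  have nG: "n \<in> carrier G" using n N.subset by auto
  have fc: "f n \<in> carrier H" "f x \<in> carrier H" and fn: "f n \<in> M"
    using f n nG x by (auto simp: hom_modulo_def)
  have "M #>\<^bsub>H\<^esub> f y = M #>\<^bsub>H\<^esub> (f n \<otimes>\<^bsub>H\<^esub> f x)"
    using f nG x n by (auto simp: hom_modulo_def)
  also have "\<dots> = (M #>\<^bsub>H\<^esub> f n) #>\<^bsub>H\<^esub> f x"
    using fc by (simp add: M.coset_mult_assoc M.subset)
  also have "M #>\<^bsub>H\<^esub> f n = M"
    using fn fc M.coset_join2 M.subgroup_axioms by blast
  finally show ?thesis .
qed

lemma quot_map_coset: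
  assumes N: "N \<lhd> G" and M: "M \<lhd> H" and f: "hom_modulo G N H M f" and x: "x \<in> carrier G"
  shows "quot_map G N H M f (N #>\<^bsub>G\<^esub> x) = M #>\<^bsub>H\<^esub> f x"
proof -
  interpret N: normal N G by (rule N)
  have "x \<in> N #>\<^bsub>G\<^esub> x"
    using x N.rcos_self N.subgroup_axioms by blast
  then have "(\<lambda>y. M #>\<^bsub>H\<^esub> f y) ` (N #>\<^bsub>G\<^esub> x) = {M #>\<^bsub>H\<^esub> f x}"
    using hom_modulo_coset_const[OF N M f x] by blast
  then show ?thesis
    using x by (simp add: quot_map_def carrier_FactGroup)
qed

lemma quot_map_in_ext_hom:
  assumes N: "N \<lhd> G" and M: "M \<lhd> H" and f: "hom_modulo G N H M f"
  shows "quot_map G N H M f \<in> ext_hom (G Mod N) (H Mod M)"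
proof -
  interpret N: normal N G by (rule N)
  interpret M: normal M H by (rule M)
  have fc: "f x \<in> carrier H" if "x \<in> carrier G" for x
    using f that by (auto simp: hom_modulo_def)
  have fm: "M #>\<^bsub>H\<^esub> f (x \<otimes>\<^bsub>G\<^esub> y) = M #>\<^bsub>H\<^esub> (f x \<otimes>\<^bsub>H\<^esub> f y)"
    if "x \<in> carrier G" "y \<in> carrier G" for x y
    using f that by (auto simp: hom_modulo_def)
  note qc = quot_map_coset[OF N M f]
  have "quot_map G N H M f \<in> hom (G Mod N) (H Mod M)"
  proof (rule homI)
    show "quot_map G N H M f X \<in> carrier (H Mod M)" if "X \<in> carrier (G Mod N)" for X
      using that fc by (auto simp: carrier_FactGroup qc)
    show "quot_map G N H M f (X \<otimes>\<^bsub>G Mod N\<^esub> Y)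
        = quot_map G N H M f X \<otimes>\<^bsub>H Mod M\<^esub> quot_map G N H M f Y"
      if "X \<in> carrier (G Mod N)" "Y \<in> carrier (G Mod N)" for X Y
      using that fc by (auto simp: carrier_FactGroup qc N.rcos_sum M.rcos_sum fm)
  qed
  then show ?thesis
    by (simp add: ext_hom_def quot_map_def)
qed

lemma FactGroup_extensionalityI:
  assumes "u \<in> extensional (carrier (G Mod N))" "v \<in> extensional (carrier (G Mod N))"
    and "\<And>x. x \<in> carrier G \<Longrightarrow> u (N #>\<^bsub>G\<^esub> x) = v (N #>\<^bsub>G\<^esub> x)"
  shows "u = v"
  using assms by (intro extensionalityI[of u "carrier (G Mod N)" v]) (auto simp: carrier_FactGroup)

lemma quot_map_extensional [simp]: "quot_map G N H M f \<in> extensional (carrier (G Mod N))"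
  by (simp add: quot_map_def)

lemma quot_map_ident:
  assumes N: "N \<lhd> G"
  shows "quot_map G N G N (\<lambda>x\<in>carrier G. x) = (\<lambda>X\<in>carrier (G Mod N). X)"
proof -
  interpret N: normal N G by (rule N)
  have "hom_modulo G N G N (\<lambda>x\<in>carrier G. x)"
    using N.subset by (auto simp: hom_modulo_def)
  from quot_map_coset[OF N N this] show ?thesis
    by (intro FactGroup_extensionalityI[where G = G and N = N]) (auto simp add: carrier_FactGroup quot_map_def)
qed

text \<open>The composite is again multiplicative modulo \<open>N\<close>: \<open>f (x y)\<close> and \<open>f x f y\<close> agree
  modulo \<open>M\<close>, hence so do their images under \<open>g\<close> modulo \<open>N\<close>.\<close>

lemma quot_map_compose:
  assumes L: "L \<lhd> G" and M: "M \<lhd> H" and N: "N \<lhd> K"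
    and f: "hom_modulo G L H M f" and g: "hom_modulo H M K N g"
  shows "quot_map G L K N (compose (carrier G) g f)
    = compose (carrier (G Mod L)) (quot_map H M K N g) (quot_map G L H M f)"
proof -
  interpret L: normal L G by (rule L)
  interpret M: normal M H by (rule M)
  interpret N: normal N K by (rule N)
  have fc: "f x \<in> carrier H" if "x \<in> carrier G" for x
    using f that by (auto simp: hom_modulo_def)
  have gc: "g y \<in> carrier K" if "y \<in> carrier H" for y
    using g that by (auto simp: hom_modulo_def)
  have self: "f (x \<otimes>\<^bsub>G\<^esub> y) \<in> M #>\<^bsub>H\<^esub> (f x \<otimes>\<^bsub>H\<^esub> f y)"
    if "x \<in> carrier G" "y \<in> carrier G" for x y
    using f that fc M.rcos_self[of "f (x \<otimes>\<^bsub>G\<^esub> y)" M] M.subgroup_axioms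
    by (auto simp: hom_modulo_def)
  have gf: "hom_modulo G L K N (compose (carrier G) g f)"
    unfolding hom_modulo_def
  proof (intro conjI ballI)
    show "compose (carrier G) g f \<in> carrier G \<rightarrow> carrier K"
      using fc gc by (auto simp: compose_def)
    show "compose (carrier G) g f ` L \<subseteq> N"
      using f g L.subset by (fastforce simp: hom_modulo_def compose_def)
    fix x y assume xy: "x \<in> carrier G" "y \<in> carrier G"
    have "N #>\<^bsub>K\<^esub> g (f (x \<otimes>\<^bsub>G\<^esub> y)) = N #>\<^bsub>K\<^esub> g (f x \<otimes>\<^bsub>H\<^esub> f y)"
      using hom_modulo_coset_const[OF M N g _ self] xy fc by simp
    also have "\<dots> = N #>\<^bsub>K\<^esub> (g (f x) \<otimes>\<^bsub>K\<^esub> g (f y))"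
      using g fc xy by (auto simp: hom_modulo_def)
    finally show "N #>\<^bsub>K\<^esub> compose (carrier G) g f (x \<otimes>\<^bsub>G\<^esub> y)
        = N #>\<^bsub>K\<^esub> (compose (carrier G) g f x \<otimes>\<^bsub>K\<^esub> compose (carrier G) g f y)"
      using xy by (simp add: compose_def)
  qed
  have "N #>\<^bsub>G\<^esub> x \<in> carrier (G Mod N)" if "x \<in> carrier G" for N x
    using that by (simp add: carrier_FactGroup)
  then show ?thesis
    by (intro FactGroup_extensionalityI[where G = G and N = L])
      (simp_all add: compose_eq quot_map_coset[OF L N gf] quot_map_coset[OF L M f]
        quot_map_coset[OF M N g] fc)
qed

lemma comm_group_FactGroupI:
  assumes N: "N \<lhd> G" and der: "derived G (carrier G) \<subseteq> N"
  shows "comm_group (G Mod N)"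
proof -
  interpret N: normal N G by (rule N)
  have "N #>\<^bsub>G\<^esub> (x \<otimes>\<^bsub>G\<^esub> y) = N #>\<^bsub>G\<^esub> (y \<otimes>\<^bsub>G\<^esub> x)" if xy: "x \<in> carrier G" "y \<in> carrier G" for x y
  proof -
    have "x \<otimes>\<^bsub>G\<^esub> y \<otimes>\<^bsub>G\<^esub> inv\<^bsub>G\<^esub> x \<otimes>\<^bsub>G\<^esub> inv\<^bsub>G\<^esub> y \<in> derived G (carrier G)"
      using xy unfolding derived_def by (intro generate.incl) blast
    then have "x \<otimes>\<^bsub>G\<^esub> y \<otimes>\<^bsub>G\<^esub> inv\<^bsub>G\<^esub> (y \<otimes>\<^bsub>G\<^esub> x) \<in> N"
      using xy der by (auto simp: N.inv_mult_group N.m_assoc)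
    then have "x \<otimes>\<^bsub>G\<^esub> y \<in> N #>\<^bsub>G\<^esub> (y \<otimes>\<^bsub>G\<^esub> x)"
      using xy N.rcos_module_rev N.is_group by simp
    then show ?thesis
      using N.repr_independence[of "x \<otimes>\<^bsub>G\<^esub> y" N "y \<otimes>\<^bsub>G\<^esub> x"] xy N.subgroup_axioms by simp
  qed
  then show ?thesis
    using N.factorgroup_is_group
    by (intro group.group_comm_groupI) (auto simp: carrier_FactGroup N.rcos_sum)
qed


section \<open>Groups of homomorphisms\<close>

lemma ext_homI:
  assumes "u \<in> extensional (carrier A)"
    and "\<And>x. x \<in> carrier A \<Longrightarrow> u x \<in> carrier C"
    and "\<And>x y. \<lbrakk>x \<in> carrier A; y \<in> carrier A\<rbrakk> \<Longrightarrow> u (x \<otimes>\<^bsub>A\<^esub> y) = u x \<otimes>\<^bsub>C\<^esub> u y"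
  shows "u \<in> ext_hom A C"
  using assms by (auto simp: ext_hom_def hom_def)

lemma ext_homD:
  assumes "u \<in> ext_hom A C"
  shows "u \<in> extensional (carrier A)" "u \<in> hom A C"
    "\<And>x. x \<in> carrier A \<Longrightarrow> u x \<in> carrier C"
    "\<And>x y. \<lbrakk>x \<in> carrier A; y \<in> carrier A\<rbrakk> \<Longrightarrow> u (x \<otimes>\<^bsub>A\<^esub> y) = u x \<otimes>\<^bsub>C\<^esub> u y"
  using assms by (auto simp: ext_hom_def hom_def)

lemma ext_hom_compose:
  assumes A: "group A" and u: "u \<in> ext_hom A B" and v: "v \<in> ext_hom B C"
  shows "compose (carrier A) v u \<in> ext_hom A C"
proof -
  interpret A: group A by (rule A)
  show ?thesis
    by (rule ext_homI) (simp_all add: compose_eq ext_homD[OF u] ext_homD[OF v])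
qed

lemma ext_hom_ident: "group A \<Longrightarrow> (\<lambda>x\<in>carrier A. x) \<in> ext_hom A A"
  by (intro ext_homI) (auto simp: group.is_monoid monoid.m_closed)

lemma comm_group_hom_group:
  assumes A: "group A" and C: "comm_group C"
  shows "comm_group (hom_group A C)"
proof -
  interpret A: group A by (rule A)
  interpret C: comm_group C by (rule C)
  show ?thesis
  proof (rule comm_groupI)
    fix u v assume u: "u \<in> carrier (hom_group A C)" and v: "v \<in> carrier (hom_group A C)"
    have uv: "u \<in> ext_hom A C" "v \<in> ext_hom A C"
      using u v by (simp_all add: hom_group_def)
    note d = ext_homD[OF uv(1)] ext_homD[OF uv(2)]
    have "(\<lambda>x\<in>carrier A. u x \<otimes>\<^bsub>C\<^esub> v x) \<in> ext_hom A C"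
      using d by (intro ext_homI) (auto simp: C.m_ac)
    then show "u \<otimes>\<^bsub>hom_group A C\<^esub> v \<in> carrier (hom_group A C)"
      by (simp add: hom_group_def)
    show "u \<otimes>\<^bsub>hom_group A C\<^esub> v = v \<otimes>\<^bsub>hom_group A C\<^esub> u"
      using d by (auto simp: hom_group_def C.m_comm intro!: restrict_ext)
    fix w assume "w \<in> carrier (hom_group A C)"
    then have w: "w \<in> ext_hom A C" by (simp add: hom_group_def)
    show "u \<otimes>\<^bsub>hom_group A C\<^esub> v \<otimes>\<^bsub>hom_group A C\<^esub> w
        = u \<otimes>\<^bsub>hom_group A C\<^esub> (v \<otimes>\<^bsub>hom_group A C\<^esub> w)"
      using d ext_homD[OF w] by (auto simp: hom_group_def C.m_assoc intro!: restrict_ext)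
  next
    have "(\<lambda>x\<in>carrier A. \<one>\<^bsub>C\<^esub>) \<in> ext_hom A C"
      by (intro ext_homI) auto
    then show "\<one>\<^bsub>hom_group A C\<^esub> \<in> carrier (hom_group A C)"
      by (simp add: hom_group_def)
  next
    fix u assume "u \<in> carrier (hom_group A C)"
    then have u: "u \<in> ext_hom A C" by (simp add: hom_group_def)
    note d = ext_homD[OF u]
    show "\<one>\<^bsub>hom_group A C\<^esub> \<otimes>\<^bsub>hom_group A C\<^esub> u = u"
      using d by (auto simp: hom_group_def intro!: extensionalityI[where A = "carrier A"])
    have "(\<lambda>x\<in>carrier A. inv\<^bsub>C\<^esub> u x) \<in> ext_hom A C"
      using d by (intro ext_homI) (auto simp: C.inv_mult)
    then show "\<exists>v\<in>carrier (hom_group A C). v \<otimes>\<^bsub>hom_group A C\<^esub> u = \<one>\<^bsub>hom_group A C\<^esub>"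
      using d by (intro bexI[of _ "\<lambda>x\<in>carrier A. inv\<^bsub>C\<^esub> u x"])
        (auto simp: hom_group_def intro!: restrict_ext)
  qed
qed


section \<open>Tensor products\<close>

text \<open>The bilinearity relators in the free abelian group; they generate \<^const>\<open>tensor_rel\<close>.\<close>

definition tensor_relators :: "'a monoid \<Rightarrow> 'b monoid \<Rightarrow> ('a \<times> 'b \<Rightarrow>\<^sub>0 int) set" where
  "tensor_relators A B =
     {frag_of (a \<otimes>\<^bsub>A\<^esub> a', b) - frag_of (a, b) - frag_of (a', b) | a a' b.
         a \<in> carrier A \<and> a' \<in> carrier A \<and> b \<in> carrier B} \<union>
      {frag_of (a, b \<otimes>\<^bsub>B\<^esub> b') - frag_of (a, b) - frag_of (a, b') | a b b'.
         a \<in> carrier A \<and> b \<in> carrier B \<and> b' \<in> carrier B}"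

lemma tensor_rel_eq:
  "tensor_rel A B = generate (free_Abelian_group (carrier A \<times> carrier B)) (tensor_relators A B)"
  by (simp add: tensor_rel_def tensor_relators_def)

lemma hom_free_Abelian_group_diff:
  assumes h: "h \<in> hom (free_Abelian_group S) Q" and Q: "group Q"
    and x: "Poly_Mapping.keys x \<subseteq> S" and y: "Poly_Mapping.keys y \<subseteq> S"
  shows "h (x - y) = h x \<otimes>\<^bsub>Q\<^esub> inv\<^bsub>Q\<^esub> (h y)"
proof -
  interpret h: group_hom "free_Abelian_group S" Q h
    using h Q by (simp add: group_hom_def group_hom_axioms_def)
  have "h (x \<otimes>\<^bsub>free_Abelian_group S\<^esub> inv\<^bsub>free_Abelian_group S\<^esub> y) = h x \<otimes>\<^bsub>Q\<^esub> inv\<^bsub>Q\<^esub> (h y)"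
    using x y h.hom_mult[of x "inv\<^bsub>free_Abelian_group S\<^esub> y"] h.hom_inv[of y] by simp
  then show ?thesis
    using y by simp
qed

lemma hom_free_Abelian_group_eq:
  assumes h: "h \<in> hom (free_Abelian_group S) Q" "k \<in> hom (free_Abelian_group S) Q" and Q: "group Q"
    and x: "Poly_Mapping.keys x \<subseteq> S"
    and eq: "\<And>s. s \<in> S \<Longrightarrow> h (frag_of s) = k (frag_of s)"
  shows "h x = k x"
  using x
proof (rule free_Abelian_group_induct)
  show "h 0 = k 0"
    using hom_one[OF h(1) _ Q] hom_one[OF h(2) _ Q] by simp
next
  fix x y :: "'a \<Rightarrow>\<^sub>0 int" assume "Poly_Mapping.keys x \<subseteq> S" "Poly_Mapping.keys y \<subseteq> S" "h x = k x" "h y = k y"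
  then show "h (x - y) = k (x - y)"
    using hom_free_Abelian_group_diff[OF h(1) Q] hom_free_Abelian_group_diff[OF h(2) Q] by simp
qed (rule eq)

context
  fixes A :: "'a monoid" and B :: "'b monoid"
  assumes A: "group A" and B: "group B"
begin

interpretation A: group A by (rule A)
interpretation B: group B by (rule B)
interpretation F: comm_group "free_Abelian_group (carrier A \<times> carrier B)"
  by (rule abelian_free_Abelian_group)

lemma tensor_relators_subset:
  "tensor_relators A B \<subseteq> carrier (free_Abelian_group (carrier A \<times> carrier B))"
proof -
  have "frag_of p - frag_of q - frag_of r \<in> carrier (free_Abelian_group (carrier A \<times> carrier B))"
    if "p \<in> carrier A \<times> carrier B" "q \<in> carrier A \<times> carrier B" "r \<in> carrier A \<times> carrier B" for p q r
    using that keys_diff[of "frag_of p - frag_of q" "frag_of r"] keys_diff[of "frag_of p" "frag_of q"]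
    by fastforce
  then show ?thesis
    by (auto simp: tensor_relators_def simp del: carrier_free_Abelian_group_iff)
qed

lemma tensor_rel_normal: "tensor_rel A B \<lhd> free_Abelian_group (carrier A \<times> carrier B)"
  unfolding tensor_rel_eq F.normal_iff_subgroup
  by (rule F.generate_is_subgroup[OF tensor_relators_subset])

lemma comm_group_tensor: "comm_group (tensor A B)"
  unfolding tensor_def using F.abelian_FactGroup tensor_rel_normal F.normal_iff_subgroup by blast

lemma pure_tensor_closed:
  assumes "a \<in> carrier A" "b \<in> carrier B"
  shows "pure_tensor A B a b \<in> carrier (tensor A B)"
  using assms by (auto simp: pure_tensor_def tensor_def carrier_FactGroup)

text \<open>Pure tensors generate the tensor product, so they determine the homomorphisms on it.\<close>

lemma tensor_hom_eqI:
  assumes Q: "group Q" and u: "u \<in> ext_hom (tensor A B) Q" and v: "v \<in> ext_hom (tensor A B) Q"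
    and eq: "\<And>a b. \<lbrakk>a \<in> carrier A; b \<in> carrier B\<rbrakk> \<Longrightarrow> u (pure_tensor A B a b) = v (pure_tensor A B a b)"
  shows "u = v"
proof (rule FactGroup_extensionalityI)
  let ?F = "free_Abelian_group (carrier A \<times> carrier B)"
  let ?c = "\<lambda>x. tensor_rel A B #>\<^bsub>?F\<^esub> x"
  interpret R: normal "tensor_rel A B" ?F by (rule tensor_rel_normal)
  show "u \<in> extensional (carrier (?F Mod tensor_rel A B))"
    "v \<in> extensional (carrier (?F Mod tensor_rel A B))"
    using u v by (auto simp: ext_hom_def tensor_def)
  have "w \<circ> ?c \<in> hom ?F Q" if "w \<in> ext_hom (tensor A B) Q" for w
    using that R.r_coset_hom_Mod Group.hom_compose[of ?c ?F "tensor A B" w Q]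
    by (simp add: ext_hom_def tensor_def)
  from hom_free_Abelian_group_eq[OF this[OF u] this[OF v] Q]
  show "u (?c x) = v (?c x)" if "x \<in> carrier ?F" for x
    using that eq by (auto simp: pure_tensor_def)
qed

text \<open>A homomorphism on the free abelian group that is bilinear on generators kills the
  relations of the tensor product.\<close>

lemma tensor_rel_in_kernel:
  assumes Q: "comm_group Q" and h: "h \<in> hom (free_Abelian_group (carrier A \<times> carrier B)) Q"
    and left: "\<And>a a' b. \<lbrakk>a \<in> carrier A; a' \<in> carrier A; b \<in> carrier B\<rbrakk>
      \<Longrightarrow> h (frag_of (a \<otimes>\<^bsub>A\<^esub> a', b)) = h (frag_of (a, b)) \<otimes>\<^bsub>Q\<^esub> h (frag_of (a', b))"
    and right: "\<And>a b b'. \<lbrakk>a \<in> carrier A; b \<in> carrier B; b' \<in> carrier B\<rbrakk>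
      \<Longrightarrow> h (frag_of (a, b \<otimes>\<^bsub>B\<^esub> b')) = h (frag_of (a, b)) \<otimes>\<^bsub>Q\<^esub> h (frag_of (a, b'))"
    and r: "r \<in> tensor_rel A B"
  shows "h r = \<one>\<^bsub>Q\<^esub>"
proof -
  let ?F = "free_Abelian_group (carrier A \<times> carrier B)"
  interpret Q: comm_group Q by (rule Q)
  interpret h: group_hom ?F Q h
    using h by (simp add: group_hom_def group_hom_axioms_def Q.is_group)
  have c: "h (frag_of p) \<in> carrier Q" if "p \<in> carrier A \<times> carrier B" for p
    using that by simp
  have d: "h (frag_of p - frag_of q - frag_of s) = h (frag_of p) \<otimes>\<^bsub>Q\<^esub> inv\<^bsub>Q\<^esub> (h (frag_of q)) \<otimes>\<^bsub>Q\<^esub> inv\<^bsub>Q\<^esub> (h (frag_of s))"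
    if "p \<in> carrier A \<times> carrier B" "q \<in> carrier A \<times> carrier B" "s \<in> carrier A \<times> carrier B" for p q s
  proof -
    have "Poly_Mapping.keys (frag_of p - frag_of q) \<subseteq> carrier A \<times> carrier B"
      using that keys_diff[of "frag_of p" "frag_of q"] by fastforce
    then show ?thesis
      using that by (simp add: hom_free_Abelian_group_diff[OF h Q.is_group])
  qed
  have e: "x \<otimes>\<^bsub>Q\<^esub> y \<otimes>\<^bsub>Q\<^esub> inv\<^bsub>Q\<^esub> x \<otimes>\<^bsub>Q\<^esub> inv\<^bsub>Q\<^esub> y = \<one>\<^bsub>Q\<^esub>" if "x \<in> carrier Q" "y \<in> carrier Q" for x y
    using that by (metis Q.inv_closed Q.inv_solve_right Q.l_one Q.m_closed Q.m_comm Q.r_inv)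
  have "h y = \<one>\<^bsub>Q\<^esub>" if "y \<in> tensor_relators A B" for y
    using that by (auto simp: tensor_relators_def d left right e c)
  then have "tensor_relators A B \<subseteq> kernel ?F Q h"
    using tensor_relators_subset by (auto simp only: kernel_def)
  then have "tensor_rel A B \<subseteq> kernel ?F Q h"
    unfolding tensor_rel_eq
    using F.generate_subgroup_incl h.subgroup_kernel by blast
  then show ?thesis
    using r by (auto simp: kernel_def)
qed

text \<open>The universal property of the tensor product.\<close>

lemma tensor_universal:
  assumes Q: "comm_group Q"
    and closed: "\<And>a b. \<lbrakk>a \<in> carrier A; b \<in> carrier B\<rbrakk> \<Longrightarrow> \<beta> a b \<in> carrier Q"
    and left: "\<And>a a' b. \<lbrakk>a \<in> carrier A; a' \<in> carrier A; b \<in> carrier B\<rbrakk>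
      \<Longrightarrow> \<beta> (a \<otimes>\<^bsub>A\<^esub> a') b = \<beta> a b \<otimes>\<^bsub>Q\<^esub> \<beta> a' b"
    and right: "\<And>a b b'. \<lbrakk>a \<in> carrier A; b \<in> carrier B; b' \<in> carrier B\<rbrakk>
      \<Longrightarrow> \<beta> a (b \<otimes>\<^bsub>B\<^esub> b') = \<beta> a b \<otimes>\<^bsub>Q\<^esub> \<beta> a b'"
  obtains w where "w \<in> ext_hom (tensor A B) Q"
    "\<And>a b. \<lbrakk>a \<in> carrier A; b \<in> carrier B\<rbrakk> \<Longrightarrow> w (pure_tensor A B a b) = \<beta> a b"
proof -
  let ?F = "free_Abelian_group (carrier A \<times> carrier B)"
  interpret Q: comm_group Q by (rule Q)
  obtain h where h: "h \<in> hom ?F Q"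
    and hf: "\<And>p. p \<in> carrier A \<times> carrier B \<Longrightarrow> h (frag_of p) = case_prod \<beta> p"
  proof (rule Q.free_Abelian_group_universal[of "case_prod \<beta>" "carrier A \<times> carrier B"])
    show "case_prod \<beta> ` (carrier A \<times> carrier B) \<subseteq> carrier Q"
      using closed by auto
  qed (rule that)
  have ker: "h r = \<one>\<^bsub>Q\<^esub>" if "r \<in> tensor_rel A B" for r
    using tensor_rel_in_kernel[OF Q h _ _ that] left right by (simp add: hf)
  have const: "h x = h y" if "x \<in> carrier ?F" "y \<in> carrier ?F"
    "tensor_rel A B #>\<^bsub>?F\<^esub> x = tensor_rel A B #>\<^bsub>?F\<^esub> y" for x y
  proof -
    interpret R: normal "tensor_rel A B" ?F by (rule tensor_rel_normal)
    have "x \<in> tensor_rel A B #>\<^bsub>?F\<^esub> y"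
      using F.rcos_self[of x] that R.subgroup_axioms by auto
    then obtain r where r: "r \<in> tensor_rel A B" "x = r \<otimes>\<^bsub>?F\<^esub> y"
      by (auto simp: r_coset_def)
    have "h x = h r \<otimes>\<^bsub>Q\<^esub> h y"
      unfolding r(2) using r(1) that R.subset by (intro hom_mult[OF h]) blast+
    then show ?thesis
      using ker[OF r(1)] that h by (simp add: hom_in_carrier)
  qed
  obtain k where k: "k \<in> hom (tensor A B) Q"
    and kh: "\<And>x. x \<in> carrier ?F \<Longrightarrow> k (tensor_rel A B #>\<^bsub>?F\<^esub> x) = h x"
    using FactGroup_universal[OF h tensor_rel_normal const] unfolding tensor_def by blast
  interpret T: comm_group "tensor A B" by (rule comm_group_tensor)
  show ?thesis
  proof
    show "restrict k (carrier (tensor A B)) \<in> ext_hom (tensor A B) Q"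
      by (rule ext_homI) (simp_all add: hom_in_carrier[OF k] hom_mult[OF k])
    show "restrict k (carrier (tensor A B)) (pure_tensor A B a b) = \<beta> a b"
      if "a \<in> carrier A" "b \<in> carrier B" for a b
      using that pure_tensor_closed kh[of "frag_of (a, b)"] hf by (simp add: pure_tensor_def)
  qed
qed

text \<open>A difference in the group of relations gives an equation in the tensor product; the two
  bilinearity laws of pure tensors are instances.\<close>

lemma tensor_coset_mult:
  assumes r: "frag_of p - frag_of q - frag_of s \<in> tensor_rel A B"
    and qs: "q \<in> carrier A \<times> carrier B" "s \<in> carrier A \<times> carrier B"
  defines "F \<equiv> free_Abelian_group (carrier A \<times> carrier B)"
  shows "tensor_rel A B #>\<^bsub>F\<^esub> frag_of p
    = (tensor_rel A B #>\<^bsub>F\<^esub> frag_of q) \<otimes>\<^bsub>tensor A B\<^esub> (tensor_rel A B #>\<^bsub>F\<^esub> frag_of s)"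
proof -
  interpret R: normal "tensor_rel A B" F
    unfolding F_def by (rule tensor_rel_normal)
  have qsF: "frag_of q \<in> carrier F" "frag_of s \<in> carrier F"
    using qs by (simp_all add: F_def)
  have "frag_of p = (frag_of p - frag_of q - frag_of s) \<otimes>\<^bsub>F\<^esub> (frag_of q \<otimes>\<^bsub>F\<^esub> frag_of s)"
    by (simp add: F_def)
  then have "frag_of p \<in> tensor_rel A B #>\<^bsub>F\<^esub> (frag_of q \<otimes>\<^bsub>F\<^esub> frag_of s)"
    using r unfolding r_coset_def by blast
  then have "tensor_rel A B #>\<^bsub>F\<^esub> frag_of p = tensor_rel A B #>\<^bsub>F\<^esub> (frag_of q \<otimes>\<^bsub>F\<^esub> frag_of s)"
    using R.repr_independence[OF _ _ R.subgroup_axioms] R.m_closed[OF qsF] by metis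
  then show ?thesis
    using R.rcos_sum[OF qsF] by (simp add: tensor_def F_def)
qed

lemma pure_tensor_mult_left:
  assumes "a \<in> carrier A" "a' \<in> carrier A" "b \<in> carrier B"
  shows "pure_tensor A B (a \<otimes>\<^bsub>A\<^esub> a') b
    = pure_tensor A B a b \<otimes>\<^bsub>tensor A B\<^esub> pure_tensor A B a' b"
  unfolding pure_tensor_def using assms
  by (intro tensor_coset_mult)
    (auto simp: tensor_rel_eq tensor_relators_def intro!: generate.incl)

lemma pure_tensor_mult_right:
  assumes "a \<in> carrier A" "b \<in> carrier B" "b' \<in> carrier B"
  shows "pure_tensor A B a (b \<otimes>\<^bsub>B\<^esub> b')
    = pure_tensor A B a b \<otimes>\<^bsub>tensor A B\<^esub> pure_tensor A B a b'"
  unfolding pure_tensor_def using assms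
  by (intro tensor_coset_mult)
    (auto simp: tensor_rel_eq tensor_relators_def intro!: generate.incl)

end

text \<open>The homomorphism of free abelian groups that defines \<open>h \<otimes> k\<close> respects the relations:
  followed by the projection onto the target it is bilinear on generators.\<close>

lemma tensor_map_hom_modulo:
  assumes A: "group A" and B: "group B" and A': "group A'" and B': "group B'"
    and h: "h \<in> hom A A'" and k: "k \<in> hom B B'"
  shows "hom_modulo (free_Abelian_group (carrier A \<times> carrier B)) (tensor_rel A B)
    (free_Abelian_group (carrier A' \<times> carrier B')) (tensor_rel A' B')
    (frag_extend (\<lambda>(a, b). frag_of (h a, k b)))"
proof (rule hom_imp_hom_modulo)
  let ?F = "free_Abelian_group (carrier A \<times> carrier B)"
  let ?F' = "free_Abelian_group (carrier A' \<times> carrier B')"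
  let ?e = "frag_extend (\<lambda>(a, b). frag_of (h a, k b))"
  let ?c = "\<lambda>x. tensor_rel A' B' #>\<^bsub>?F'\<^esub> x"
  interpret A: group A by (rule A)
  interpret B: group B by (rule B)
  interpret F': comm_group ?F' by (rule abelian_free_Abelian_group)
  interpret R': normal "tensor_rel A' B'" ?F' by (rule tensor_rel_normal[OF A' B'])
  have ek: "Poly_Mapping.keys (?e x) \<subseteq> carrier A' \<times> carrier B'"
    if "Poly_Mapping.keys x \<subseteq> carrier A \<times> carrier B" for x
  proof (rule order.trans[OF keys_frag_extend], rule UN_least)
    fix p assume "p \<in> Poly_Mapping.keys x"
    then obtain a b where "p = (a, b)" "a \<in> carrier A" "b \<in> carrier B"
      using \<open>Poly_Mapping.keys x \<subseteq> carrier A \<times> carrier B\<close> by blast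
    then show "Poly_Mapping.keys (case p of (a, b) \<Rightarrow> frag_of (h a, k b)) \<subseteq> carrier A' \<times> carrier B'"
      using hom_in_carrier[OF h] hom_in_carrier[OF k] by simp
  qed
  show e: "?e \<in> hom ?F ?F'"
    using ek by (auto simp: hom_def frag_extend_add)
  have ce: "?c \<circ> ?e \<in> hom ?F (tensor A' B')"
    using Group.hom_compose[OF e R'.r_coset_hom_Mod] by (simp add: tensor_def)
  have cf: "(?c \<circ> ?e) (frag_of (a, b)) = pure_tensor A' B' (h a) (k b)" for a b
    by (simp add: pure_tensor_def)
  show "?e ` tensor_rel A B \<subseteq> tensor_rel A' B'"
  proof (intro image_subsetI)
    fix r assume r: "r \<in> tensor_rel A B"
    have "(?c \<circ> ?e) r = \<one>\<^bsub>tensor A' B'\<^esub>"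
      using A' B' h k
      by (intro tensor_rel_in_kernel[OF A B comm_group_tensor[OF A' B'] ce _ _ r])
        (simp_all add: cf hom_mult hom_in_carrier pure_tensor_mult_left pure_tensor_mult_right
          del: o_apply)
    then have "?c (?e r) = tensor_rel A' B'"
      by (simp add: tensor_def)
    moreover have "?e r \<in> carrier ?F'"
      using r e normal_imp_subgroup[OF tensor_rel_normal[OF A B]]
      by (meson hom_in_carrier subgroup.mem_carrier)
    ultimately show "?e r \<in> tensor_rel A' B'"
      using F'.coset_join1 R'.subgroup_axioms by blast
  qed
qed

lemma tensor_map_in_ext_hom:
  assumes "group A" "group B" "group A'" "group B'" "h \<in> hom A A'" "k \<in> hom B B'"
  shows "tensor_map A B A' B' h k \<in> ext_hom (tensor A B) (tensor A' B')"
  unfolding tensor_map_def tensor_def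
  by (rule quot_map_in_ext_hom) (simp_all add: assms tensor_rel_normal tensor_map_hom_modulo)

lemma tensor_map_pure_tensor:
  assumes "group A" "group B" "group A'" "group B'" "h \<in> hom A A'" "k \<in> hom B B'"
    and "a \<in> carrier A" "b \<in> carrier B"
  shows "tensor_map A B A' B' h k (pure_tensor A B a b) = pure_tensor A' B' (h a) (k b)"
  unfolding tensor_map_def pure_tensor_def
  by (subst quot_map_coset) (simp_all add: assms tensor_rel_normal tensor_map_hom_modulo)

lemma tensor_map_ident:
  assumes A: "group A" and B: "group B"
  shows "tensor_map A B A B (\<lambda>x\<in>carrier A. x) (\<lambda>x\<in>carrier B. x) = (\<lambda>x\<in>carrier (tensor A B). x)"
proof (rule tensor_hom_eqI[OF A B])
  have T: "group (tensor A B)"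
    using comm_group_tensor[OF A B] by (simp add: comm_group_def)
  show "group (tensor A B)" by (rule T)
  note id = ext_hom_ident[THEN ext_homD(2)]
  show "tensor_map A B A B (\<lambda>x\<in>carrier A. x) (\<lambda>x\<in>carrier B. x) \<in> ext_hom (tensor A B) (tensor A B)"
    using A B by (intro tensor_map_in_ext_hom id)
  show "(\<lambda>x\<in>carrier (tensor A B). x) \<in> ext_hom (tensor A B) (tensor A B)"
    by (rule ext_hom_ident[OF T])
  show "tensor_map A B A B (\<lambda>x\<in>carrier A. x) (\<lambda>x\<in>carrier B. x) (pure_tensor A B a b)
      = (\<lambda>x\<in>carrier (tensor A B). x) (pure_tensor A B a b)"
    if "a \<in> carrier A" "b \<in> carrier B" for a b
    using that A B id[OF A] id[OF B] by (simp add: tensor_map_pure_tensor pure_tensor_closed)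
qed

lemma tensor_map_compose:
  assumes A: "group A" and B: "group B" and A': "group A'" and B': "group B'"
    and A'': "group A''" and B'': "group B''"
    and h: "h \<in> ext_hom A A'" "h' \<in> ext_hom A' A''"
    and k: "k \<in> ext_hom B B'" "k' \<in> ext_hom B' B''"
  shows "tensor_map A B A'' B'' (compose (carrier A) h' h) (compose (carrier B) k' k)
    = compose (carrier (tensor A B)) (tensor_map A' B' A'' B'' h' k') (tensor_map A B A' B' h k)"
proof (rule tensor_hom_eqI[OF A B])
  note hd = h[THEN ext_homD(2)] k[THEN ext_homD(2)]
  note hc = ext_hom_compose[OF A h, THEN ext_homD(2)] ext_hom_compose[OF B k, THEN ext_homD(2)]
  have T: "group (tensor A B)" and T'': "group (tensor A'' B'')"
    using comm_group_tensor A B A'' B'' by (auto simp: comm_group_def)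
  show "group (tensor A'' B'')" by (rule T'')
  show "tensor_map A B A'' B'' (compose (carrier A) h' h) (compose (carrier B) k' k)
      \<in> ext_hom (tensor A B) (tensor A'' B'')"
    by (intro tensor_map_in_ext_hom hc assms)
  show "compose (carrier (tensor A B)) (tensor_map A' B' A'' B'' h' k') (tensor_map A B A' B' h k)
      \<in> ext_hom (tensor A B) (tensor A'' B'')"
    by (rule ext_hom_compose[OF T tensor_map_in_ext_hom tensor_map_in_ext_hom]; intro hd assms)
  show "tensor_map A B A'' B'' (compose (carrier A) h' h) (compose (carrier B) k' k) (pure_tensor A B a b)
      = compose (carrier (tensor A B)) (tensor_map A' B' A'' B'' h' k') (tensor_map A B A' B' h k)
          (pure_tensor A B a b)"
    if "a \<in> carrier A" "b \<in> carrier B" for a b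
    using that A B A' B' A'' B'' hd hc
    by (simp add: tensor_map_pure_tensor compose_eq pure_tensor_closed hom_in_carrier)
qed


section \<open>The quotient \<open>G/G'B\<close>\<close>

lemma derived_mult_normal:
  assumes G: "group G" and B: "subgroup B G"
  shows "derived_mult (G, B) \<lhd> G" "derived G (carrier G) \<subseteq> derived_mult (G, B)"
    "B \<subseteq> derived_mult (G, B)"
proof -
  interpret G: group G by (rule G)
  interpret B: subgroup B G by (rule B)
  interpret D: normal "derived G (carrier G)" G
    by (rule G.derived_is_normal[OF G.normal_self])
  have sub: "subgroup (derived_mult (G, B)) G"
    unfolding derived_mult_def split
    by (rule G.mult_norm_subgroup[OF D.normal_axioms B])
  show der: "derived G (carrier G) \<subseteq> derived_mult (G, B)"
  proof
    fix d assume d: "d \<in> derived G (carrier G)"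
    then have "d = d \<otimes>\<^bsub>G\<^esub> \<one>\<^bsub>G\<^esub>" using D.subset by auto
    then show "d \<in> derived_mult (G, B)"
      using d B.one_closed unfolding derived_mult_def set_mult_def split by blast
  qed
  show "B \<subseteq> derived_mult (G, B)"
  proof
    fix b assume b: "b \<in> B"
    then have "b = \<one>\<^bsub>G\<^esub> \<otimes>\<^bsub>G\<^esub> b" by auto
    then show "b \<in> derived_mult (G, B)"
      using b D.one_closed unfolding derived_mult_def set_mult_def split by blast
  qed
  \<comment> \<open>any subgroup that contains \<open>G'\<close> is normal: conjugation changes \<open>h\<close> by a commutator\<close>
  show "derived_mult (G, B) \<lhd> G"
  proof (rule G.normal_invI[OF sub])
    fix x h assume x: "x \<in> carrier G" and h: "h \<in> derived_mult (G, B)"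
    have hG: "h \<in> carrier G" using h sub subgroup.subset by blast
    have "x \<otimes>\<^bsub>G\<^esub> h \<otimes>\<^bsub>G\<^esub> inv\<^bsub>G\<^esub> x \<otimes>\<^bsub>G\<^esub> inv\<^bsub>G\<^esub> h \<in> derived G (carrier G)"
      using x hG unfolding derived_def by (intro generate.incl) blast
    then have "x \<otimes>\<^bsub>G\<^esub> h \<otimes>\<^bsub>G\<^esub> inv\<^bsub>G\<^esub> x \<otimes>\<^bsub>G\<^esub> inv\<^bsub>G\<^esub> h \<otimes>\<^bsub>G\<^esub> h \<in> derived_mult (G, B)"
      using subgroup.m_closed[OF sub] der h by (meson subsetD)
    then show "x \<otimes>\<^bsub>G\<^esub> h \<otimes>\<^bsub>G\<^esub> inv\<^bsub>G\<^esub> x \<in> derived_mult (G, B)"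
      using x hG by (simp add: G.m_assoc)
  qed
qed

lemma comm_group_ab_quot:
  assumes "group G" "subgroup B G"
  shows "comm_group (ab_quot (G, B))"
  using comm_group_FactGroupI[of "derived_mult (G, B)" G] derived_mult_normal[OF assms]
  by (simp add: ab_quot_def)

lemma hom_kills_derived_mult:
  assumes G: "group G" and B: "subgroup B G" and Q: "comm_group Q" and q: "q \<in> hom G Q"
    and qB: "\<And>b. b \<in> B \<Longrightarrow> q b = \<one>\<^bsub>Q\<^esub>" and x: "x \<in> derived_mult (G, B)"
  shows "q x = \<one>\<^bsub>Q\<^esub>"
proof -
  interpret Q: comm_group Q by (rule Q)
  interpret q: group_hom G Q q
    using G q Q.is_group by (simp add: group_hom_def group_hom_axioms_def)
  have comm: "q (y \<otimes>\<^bsub>G\<^esub> z \<otimes>\<^bsub>G\<^esub> inv\<^bsub>G\<^esub> y \<otimes>\<^bsub>G\<^esub> inv\<^bsub>G\<^esub> z) = \<one>\<^bsub>Q\<^esub>"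
    if "y \<in> carrier G" "z \<in> carrier G" for y z
  proof -
    have "q (y \<otimes>\<^bsub>G\<^esub> z \<otimes>\<^bsub>G\<^esub> inv\<^bsub>G\<^esub> y \<otimes>\<^bsub>G\<^esub> inv\<^bsub>G\<^esub> z) = q z \<otimes>\<^bsub>Q\<^esub> q y \<otimes>\<^bsub>Q\<^esub> inv\<^bsub>Q\<^esub> q y \<otimes>\<^bsub>Q\<^esub> inv\<^bsub>Q\<^esub> q z"
      using that by (simp add: Q.m_comm)
    then show ?thesis
      using that by (simp add: Q.m_assoc)
  qed
  have "derived_set G (carrier G) \<subseteq> kernel G Q q"
    using comm by (auto simp: kernel_def)
  then have "derived G (carrier G) \<subseteq> kernel G Q q"
    unfolding derived_def using q.G.generate_subgroup_incl q.subgroup_kernel by blast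
  moreover obtain d b where "d \<in> derived G (carrier G)" "b \<in> B" "x = d \<otimes>\<^bsub>G\<^esub> b"
    using x by (auto simp: derived_mult_def set_mult_def)
  ultimately show ?thesis
    using qB subgroup.mem_carrier[OF B] by (auto simp: kernel_def)
qed


section \<open>Quadratic pair maps\<close>

text \<open>A morphism \<open>f : (G, B) \<rightarrow> (H, C)\<close> of \<^const>\<open>QP\<close>.\<close>

locale quadratic_pair_map = G: group G + H: group H
  for G :: "'a monoid" and H :: "'a monoid" +
  fixes B C :: "'a set" and f :: "'a \<Rightarrow> 'a"
  assumes subgroup_B: "subgroup B G" and subgroup_C: "subgroup C H"
    and mor: "f \<in> Mor QP (G, B) (H, C)"
begin

abbreviation d where "d \<equiv> dev G H f"

sublocale B: subgroup B G by (rule subgroup_B)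
sublocale C: subgroup C H by (rule subgroup_C)

lemma closed [simp, intro]: "x \<in> carrier G \<Longrightarrow> f x \<in> carrier H"
  and extensional: "f \<in> extensional (carrier G)"
  and maps_B: "b \<in> B \<Longrightarrow> f b \<in> C"
  using mor by (auto simp: QP_def PiE_iff)

lemma dev_mem: "\<lbrakk>x \<in> carrier G; y \<in> carrier G\<rbrakk> \<Longrightarrow> d x y \<in> C"
  using mor generate.incl[of "d x y" "{d a b |a b. a \<in> carrier G \<and> b \<in> carrier G}" H]
  by (auto simp: QP_def dev_subgroup_def)

lemma dev_closed [simp, intro]: "\<lbrakk>x \<in> carrier G; y \<in> carrier G\<rbrakk> \<Longrightarrow> d x y \<in> carrier H"
  using dev_mem C.mem_carrier by blast

lemma dev_mult_left: "\<lbrakk>x \<in> carrier G; y \<in> carrier G; z \<in> carrier G\<rbrakk>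
    \<Longrightarrow> d (x \<otimes>\<^bsub>G\<^esub> y) z = d x z \<otimes>\<^bsub>H\<^esub> d y z"
  and dev_mult_right: "\<lbrakk>x \<in> carrier G; y \<in> carrier G; z \<in> carrier G\<rbrakk>
    \<Longrightarrow> d x (y \<otimes>\<^bsub>G\<^esub> z) = d x y \<otimes>\<^bsub>H\<^esub> d x z"
  and dev_commutes: "\<lbrakk>x \<in> carrier G; y \<in> carrier G; z \<in> carrier G\<rbrakk>
    \<Longrightarrow> d x y \<otimes>\<^bsub>H\<^esub> f z = f z \<otimes>\<^bsub>H\<^esub> d x y"
  and dev_B: "\<lbrakk>b \<in> B; x \<in> carrier G\<rbrakk> \<Longrightarrow> d b x = \<one>\<^bsub>H\<^esub>" "\<lbrakk>b \<in> B; x \<in> carrier G\<rbrakk> \<Longrightarrow> d x b = \<one>\<^bsub>H\<^esub>"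
  using mor by (auto simp: QP_def quadratic_rel_def quadratic_def hom_def)

lemma map_mult: "\<lbrakk>x \<in> carrier G; y \<in> carrier G\<rbrakk> \<Longrightarrow> f (x \<otimes>\<^bsub>G\<^esub> y) = d x y \<otimes>\<^bsub>H\<^esub> (f x \<otimes>\<^bsub>H\<^esub> f y)"
  by (simp add: dev_def H.m_assoc H.inv_solve_left' flip: H.inv_mult_group)

text \<open>\<open>f\<close> is multiplicative as soon as one factor lies in \<open>B\<close>; in particular it is a
  homomorphism on \<open>B\<close>.\<close>

lemma map_mult_B:
  assumes "b \<in> B" "x \<in> carrier G"
  shows "f (b \<otimes>\<^bsub>G\<^esub> x) = f b \<otimes>\<^bsub>H\<^esub> f x" "f (x \<otimes>\<^bsub>G\<^esub> b) = f x \<otimes>\<^bsub>H\<^esub> f b"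
  using assms by (simp_all add: map_mult dev_B)

lemma map_one [simp]: "f \<one>\<^bsub>G\<^esub> = \<one>\<^bsub>H\<^esub>"
  using map_mult_B(1)[of "\<one>\<^bsub>G\<^esub>" "\<one>\<^bsub>G\<^esub>"] H.r_cancel_one[of "f \<one>\<^bsub>G\<^esub>" "f \<one>\<^bsub>G\<^esub>"] by simp

lemma restrict_hom: "restrict f B \<in> ext_hom (G\<lparr>carrier := B\<rparr>) (H\<lparr>carrier := C\<rparr>)"
  by (rule ext_homI) (auto simp: maps_B map_mult_B)

text \<open>Modulo any normal subgroup that contains \<open>C\<close>, the map \<open>f\<close> is a homomorphism.\<close>

lemma hom_modulo_normal:
  assumes M: "M \<lhd> H" and CM: "C \<subseteq> M"
  shows "(\<lambda>x. M #>\<^bsub>H\<^esub> f x) \<in> hom G (H Mod M)"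
    and "f ` N \<subseteq> M \<Longrightarrow> hom_modulo G N H M f"
proof -
  interpret M: normal M H by (rule M)
  have *: "M #>\<^bsub>H\<^esub> f (x \<otimes>\<^bsub>G\<^esub> y) = M #>\<^bsub>H\<^esub> (f x \<otimes>\<^bsub>H\<^esub> f y)"
    if xy: "x \<in> carrier G" "y \<in> carrier G" for x y
  proof -
    have "d x y \<in> M" using xy dev_mem CM by blast
    then have "M #>\<^bsub>H\<^esub> d x y = M"
      using xy H.coset_join2 M.subgroup_axioms by blast
    then show ?thesis
      using xy H.coset_mult_assoc[OF M.subset, of "d x y" "f x \<otimes>\<^bsub>H\<^esub> f y"] by (simp add: map_mult)
  qed
  show "(\<lambda>x. M #>\<^bsub>H\<^esub> f x) \<in> hom G (H Mod M)"
    by (rule homI) (auto simp: carrier_FactGroup * M.rcos_sum)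
  show "hom_modulo G N H M f" if "f ` N \<subseteq> M"
    using that * by (auto simp: hom_modulo_def)
qed

text \<open>\<open>H/H'C\<close> is abelian, so the homomorphism \<open>G \<rightarrow> H/H'C\<close> induced by \<open>f\<close> kills
  \<open>G'\<close> besides \<open>B\<close>.\<close>

lemma hom_modulo_derived_mult: "hom_modulo G (derived_mult (G, B)) H (derived_mult (H, C)) f"
proof -
  note n = derived_mult_normal[OF H.is_group subgroup_C]
  interpret M: normal "derived_mult (H, C)" H by (rule n(1))
  let ?q = "\<lambda>x. derived_mult (H, C) #>\<^bsub>H\<^esub> f x"
  have "?q x = derived_mult (H, C)" if "x \<in> derived_mult (G, B)" for x
  proof -
    have "?q b = \<one>\<^bsub>ab_quot (H, C)\<^esub>" if "b \<in> B" for b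
      using that maps_B n(3) H.coset_join2[OF _ M.subgroup_axioms] by (auto simp: ab_quot_def)
    with hom_kills_derived_mult[OF G.is_group subgroup_B comm_group_ab_quot[OF H.is_group subgroup_C], of ?q]
    show ?thesis
      using that hom_modulo_normal(1)[OF n(1,3)] by (simp add: ab_quot_def)
  qed
  then have "f ` derived_mult (G, B) \<subseteq> derived_mult (H, C)"
    using H.coset_join1[OF _ _ M.subgroup_axioms]
      normal_imp_subgroup[OF derived_mult_normal(1)[OF G.is_group subgroup_B]]
    by (blast dest: subgroup.mem_carrier)
  then show ?thesis
    by (rule hom_modulo_normal(2)[OF n(1,3)])
qed

lemma ab_quot_map_coset:
  "x \<in> carrier G \<Longrightarrow> ab_quot_map (G, B) (H, C) f (derived_mult (G, B) #>\<^bsub>G\<^esub> x) = derived_mult (H, C) #>\<^bsub>H\<^esub> f x"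
  unfolding ab_quot_map_def fst_conv
  by (intro quot_map_coset derived_mult_normal hom_modulo_derived_mult)
    (auto simp: subgroup_B subgroup_C)

lemma ab_quot_map_in_ext_hom:
  "ab_quot_map (G, B) (H, C) f \<in> ext_hom (ab_quot (G, B)) (ab_quot (H, C))"
  unfolding ab_quot_map_def ab_quot_def fst_conv
  by (intro quot_map_in_ext_hom derived_mult_normal hom_modulo_derived_mult)
    (auto simp: subgroup_B subgroup_C)

end

lemma ident_in_QP:
  assumes G: "group G" and B: "subgroup B G"
  shows "(\<lambda>x\<in>carrier G. x) \<in> Mor QP (G, B) (G, B)"
proof -
  interpret G: group G by (rule G)
  interpret B: subgroup B G by (rule B)
  have d: "dev G G (\<lambda>x\<in>carrier G. x) a b = \<one>\<^bsub>G\<^esub>" if "a \<in> carrier G" "b \<in> carrier G" for a b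
    using that by (simp add: dev_def G.m_assoc)
  have "{dev G G (\<lambda>x\<in>carrier G. x) a b | a b. a \<in> carrier G \<and> b \<in> carrier G} \<subseteq> B"
    using d by auto
  then have "dev_subgroup G G (\<lambda>x\<in>carrier G. x) \<subseteq> B"
    unfolding dev_subgroup_def by (rule G.generate_subgroup_incl[OF _ B])
  then show ?thesis
    by (auto simp: QP_def quadratic_rel_def quadratic_def hom_def d)
qed

lemma quadratic_pair_map_ident:
  "\<lbrakk>group G; subgroup B G\<rbrakk> \<Longrightarrow> quadratic_pair_map G G B B (\<lambda>x\<in>carrier G. x)"
  by (simp add: quadratic_pair_map_def quadratic_pair_map_axioms_def ident_in_QP)

text \<open>Composition of \<open>g : (G, B) \<rightarrow> (H, C)\<close> with \<open>f : (H, C) \<rightarrow> (K, E)\<close>.\<close>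

locale quadratic_pair_map_compose =
  g: quadratic_pair_map G H B C g + f: quadratic_pair_map H K C E f
  for G H K :: "'a monoid" and B C E :: "'a set" and g f :: "'a \<Rightarrow> 'a"
begin

abbreviation fg where "fg \<equiv> compose (carrier G) f g"

text \<open>The chain rule \<open>d\<^sub>f\<^sub>g(a,b) = f(d\<^sub>g(a,b)) + d\<^sub>f(g a, g b)\<close>. It rests on
  \<open>d\<^sub>g\<close> taking values in \<open>C\<close>: there \<open>d\<^sub>f\<close> vanishes in either argument.\<close>

lemma dev_compose:
  assumes "x \<in> carrier G" "y \<in> carrier G"
  shows "dev G K fg x y = f (g.d x y) \<otimes>\<^bsub>K\<^esub> f.d (g x) (g y)"
proof -
  have "f (g (x \<otimes>\<^bsub>G\<^esub> y)) = f (g.d x y) \<otimes>\<^bsub>K\<^esub> f (g x \<otimes>\<^bsub>H\<^esub> g y)"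
    using assms by (simp add: g.map_mult f.map_mult_B(1) g.dev_mem)
  also have "\<dots> = f (g.d x y) \<otimes>\<^bsub>K\<^esub> f.d (g x) (g y) \<otimes>\<^bsub>K\<^esub> (f (g x) \<otimes>\<^bsub>K\<^esub> f (g y))"
    using assms by (simp add: f.map_mult f.H.m_assoc)
  finally show ?thesis
    using assms by (simp add: dev_def compose_eq f.H.m_assoc)
qed

lemma dev_compose_mult:
  assumes "x \<in> carrier G" "y \<in> carrier G" "z \<in> carrier G"
  shows "dev G K fg (x \<otimes>\<^bsub>G\<^esub> y) z = dev G K fg x z \<otimes>\<^bsub>K\<^esub> dev G K fg y z"
    and "dev G K fg x (y \<otimes>\<^bsub>G\<^esub> z) = dev G K fg x y \<otimes>\<^bsub>K\<^esub> dev G K fg x z"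
proof -
  \<comment> \<open>deviations of \<open>f\<close> commute with all values of \<open>f\<close>, which allows regrouping in \<open>K\<close>\<close>
  have swap: "(p \<otimes>\<^bsub>K\<^esub> q) \<otimes>\<^bsub>K\<^esub> (r \<otimes>\<^bsub>K\<^esub> s) = (p \<otimes>\<^bsub>K\<^esub> r) \<otimes>\<^bsub>K\<^esub> (q \<otimes>\<^bsub>K\<^esub> s)"
    if "p \<in> carrier K" "q \<in> carrier K" "r \<in> carrier K" "s \<in> carrier K" "q \<otimes>\<^bsub>K\<^esub> r = r \<otimes>\<^bsub>K\<^esub> q"
    for p q r s
    using that by (metis f.H.m_assoc f.H.m_closed)
  have fd: "f (g.d u v \<otimes>\<^bsub>H\<^esub> g.d u' v') = f (g.d u v) \<otimes>\<^bsub>K\<^esub> f (g.d u' v')"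
    if "u \<in> carrier G" "v \<in> carrier G" "u' \<in> carrier G" "v' \<in> carrier G" for u v u' v'
    using that by (simp add: f.map_mult_B(1) g.dev_mem)
  show "dev G K fg (x \<otimes>\<^bsub>G\<^esub> y) z = dev G K fg x z \<otimes>\<^bsub>K\<^esub> dev G K fg y z"
    using assms
    by (simp add: dev_compose g.dev_mult_left fd g.map_mult f.dev_mult_left f.dev_B g.dev_mem
        swap f.dev_commutes)
  show "dev G K fg x (y \<otimes>\<^bsub>G\<^esub> z) = dev G K fg x y \<otimes>\<^bsub>K\<^esub> dev G K fg x z"
    using assms
    by (simp add: dev_compose g.dev_mult_right fd g.map_mult f.dev_mult_right f.dev_B g.dev_mem
        swap f.dev_commutes)
qed

lemma dev_compose_commutes:
  assumes "x \<in> carrier G" "y \<in> carrier G" "z \<in> carrier G"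
  shows "dev G K fg x y \<otimes>\<^bsub>K\<^esub> fg z = fg z \<otimes>\<^bsub>K\<^esub> dev G K fg x y"
proof -
  have "f (g.d x y) \<otimes>\<^bsub>K\<^esub> f (g z) = f (g z) \<otimes>\<^bsub>K\<^esub> f (g.d x y)"
    using assms g.dev_commutes f.map_mult_B g.dev_mem g.closed by metis
  moreover have "f.d (g x) (g y) \<otimes>\<^bsub>K\<^esub> f (g z) = f (g z) \<otimes>\<^bsub>K\<^esub> f.d (g x) (g y)"
    using assms f.dev_commutes by simp
  ultimately show ?thesis
    using assms by (simp add: dev_compose compose_eq)
      (metis f.H.m_assoc f.closed f.dev_closed g.closed g.dev_closed)
qed

lemma compose_in_QP: "fg \<in> Mor QP (G, B) (K, E)"
proof -
  have mem: "dev G K fg x y \<in> E" if "x \<in> carrier G" "y \<in> carrier G" for x y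
    using that by (simp add: dev_compose f.maps_B g.dev_mem f.dev_mem f.C.m_closed)
  then have "dev_subgroup G K fg \<subseteq> E"
    unfolding dev_subgroup_def by (intro f.H.generate_subgroup_incl[OF _ f.subgroup_C]) auto
  moreover have "fg ` B \<subseteq> E"
    by (auto simp: compose_eq f.maps_B g.maps_B)
  moreover have "fg \<in> carrier G \<rightarrow>\<^sub>E carrier K"
    by (auto simp: compose_def)
  moreover have "dev G K fg b x = \<one>\<^bsub>K\<^esub>" "dev G K fg x b = \<one>\<^bsub>K\<^esub>" if "b \<in> B" "x \<in> carrier G" for b x
    using that by (simp_all add: dev_compose g.dev_B f.dev_B g.maps_B)
  moreover have "dev G K fg x y \<in> carrier K" if "x \<in> carrier G" "y \<in> carrier G" for x y
    using mem that f.C.mem_carrier by blast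
  ultimately show ?thesis
    by (auto simp: QP_def quadratic_rel_def quadratic_def dev_compose_mult dev_compose_commutes
        intro!: homI)
qed

sublocale fg: quadratic_pair_map G K B E fg
  by unfold_locales (rule compose_in_QP)

lemma ab_quot_map_compose:
  "ab_quot_map (G, B) (K, E) fg
    = compose (carrier (ab_quot (G, B))) (ab_quot_map (H, C) (K, E) f) (ab_quot_map (G, B) (H, C) g)"
  unfolding ab_quot_map_def ab_quot_def fst_conv
  by (rule quot_map_compose derived_mult_normal g.G.is_group g.H.is_group f.H.is_group
      g.subgroup_B f.subgroup_B f.subgroup_C g.hom_modulo_derived_mult f.hom_modulo_derived_mult)+

lemma restrict_compose: "restrict fg B = compose B (restrict f C) (restrict g B)"
  by (auto simp: compose_def g.maps_B)

end

lemma ab_quot_map_ident: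
  assumes "group G" "subgroup B G"
  shows "ab_quot_map (G, B) (G, B) (\<lambda>x\<in>carrier G. x) = (\<lambda>X\<in>carrier (ab_quot (G, B)). X)"
  unfolding ab_quot_map_def ab_quot_def fst_conv
  by (intro quot_map_ident derived_mult_normal assms)


section \<open>The homomorphism \<open>w\<^sub>f\<close>\<close>

lemma tensor_sq_group:
  assumes "group G" "subgroup B G"
  shows "group (ab_quot (G, B))" "group (tensor_sq (G, B))"
  using comm_group_ab_quot[OF assms] comm_group_tensor
  by (auto simp: tensor_sq_def comm_group_def)

lemma class_tensor_closed:
  assumes "group G" "subgroup B G" "a \<in> carrier G" "b \<in> carrier G"
  shows "class_tensor (G, B) a b \<in> carrier (tensor_sq (G, B))"
  using assms(3,4) unfolding class_tensor_def tensor_sq_def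
  by (intro pure_tensor_closed tensor_sq_group assms) (auto simp: ab_quot_def carrier_FactGroup)

lemma tensor_sq_hom_eqI:
  assumes G: "group G" "subgroup B G" and Q: "group Q"
    and "u \<in> ext_hom (tensor_sq (G, B)) Q" "v \<in> ext_hom (tensor_sq (G, B)) Q"
    and eq: "\<And>a b. \<lbrakk>a \<in> carrier G; b \<in> carrier G\<rbrakk>
      \<Longrightarrow> u (class_tensor (G, B) a b) = v (class_tensor (G, B) a b)"
  shows "u = v"
proof (rule tensor_hom_eqI[OF tensor_sq_group(1)[OF G] tensor_sq_group(1)[OF G] Q])
  fix X Y assume "X \<in> carrier (ab_quot (G, B))" "Y \<in> carrier (ab_quot (G, B))"
  then show "u (pure_tensor (ab_quot (G, B)) (ab_quot (G, B)) X Y)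
      = v (pure_tensor (ab_quot (G, B)) (ab_quot (G, B)) X Y)"
    using eq by (auto simp: ab_quot_def carrier_FactGroup class_tensor_def)
qed (use assms in \<open>simp_all add: tensor_sq_def\<close>)

context quadratic_pair_map
begin

lemma tensor_sq_map_in_ext_hom:
  "tensor_sq_map (G, B) (H, C) f \<in> ext_hom (tensor_sq (G, B)) (tensor_sq (H, C))"
  unfolding tensor_sq_map_def tensor_sq_def
  using ab_quot_map_in_ext_hom ext_homD(2)
  by (intro tensor_map_in_ext_hom tensor_sq_group subgroup_B subgroup_C) (auto simp: subgroup_B subgroup_C)

lemma tensor_sq_map_class_tensor:
  assumes "a \<in> carrier G" "b \<in> carrier G"
  shows "tensor_sq_map (G, B) (H, C) f (class_tensor (G, B) a b) = class_tensor (H, C) (f a) (f b)"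
proof -
  have "derived_mult (G, B) #>\<^bsub>G\<^esub> x \<in> carrier (ab_quot (G, B))" if "x \<in> carrier G" for x
    using that by (auto simp: ab_quot_def carrier_FactGroup)
  then show ?thesis
    unfolding tensor_sq_map_def class_tensor_def fst_conv
    using assms ab_quot_map_in_ext_hom[THEN ext_homD(2)]
    by (subst tensor_map_pure_tensor)
      (auto simp: ab_quot_map_coset tensor_sq_group subgroup_B subgroup_C)
qed

lemma dev_derived_mult:
  assumes C: "comm_group (H\<lparr>carrier := C\<rparr>)" and n: "n \<in> derived_mult (G, B)" and x: "x \<in> carrier G"
  shows "d n x = \<one>\<^bsub>H\<^esub>" "d x n = \<one>\<^bsub>H\<^esub>"
proof -
  have "(\<lambda>n. d n x) \<in> hom G (H\<lparr>carrier := C\<rparr>)" "(\<lambda>n. d x n) \<in> hom G (H\<lparr>carrier := C\<rparr>)"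
    using x by (auto simp: hom_def dev_mem dev_mult_left dev_mult_right)
  from this[THEN hom_kills_derived_mult[OF G.is_group subgroup_B C _ _ n]]
  show "d n x = \<one>\<^bsub>H\<^esub>" "d x n = \<one>\<^bsub>H\<^esub>"
    using x dev_B by simp_all
qed

text \<open>Since \<open>C\<close> is abelian, the bilinear map \<open>d\<^sub>f\<close> vanishes on \<open>G'\<close> as well as on \<open>B\<close>,
  hence factors through \<open>G/G'B \<otimes> G/G'B\<close>.\<close>

lemma w_map_exists:
  assumes C: "comm_group (H\<lparr>carrier := C\<rparr>)"
  obtains w where "w \<in> ext_hom (tensor_sq (G, B)) (H\<lparr>carrier := C\<rparr>)"
    "\<And>a b. \<lbrakk>a \<in> carrier G; b \<in> carrier G\<rbrakk> \<Longrightarrow> w (class_tensor (G, B) a b) = d a b"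
proof -
  let ?Q = "ab_quot (G, B)" and ?N = "derived_mult (G, B)"
  interpret N: normal ?N G
    by (rule derived_mult_normal(1)[OF G.is_group subgroup_B])
  \<comment> \<open>the bilinear map on \<open>G/G'B\<close> induced by \<open>d\<^sub>f\<close>, by choice of representatives\<close>
  define \<beta> where "\<beta> X Y = d (SOME x. x \<in> X) (SOME y. y \<in> Y)" for X Y
  have \<beta>: "\<beta> (?N #>\<^bsub>G\<^esub> a) (?N #>\<^bsub>G\<^esub> b) = d a b" if ab: "a \<in> carrier G" "b \<in> carrier G" for a b
  proof -
    have rep: "\<exists>n\<in>?N. (SOME x. x \<in> ?N #>\<^bsub>G\<^esub> a) = n \<otimes>\<^bsub>G\<^esub> a" if "a \<in> carrier G" for a
    proof -
      have "(SOME x. x \<in> ?N #>\<^bsub>G\<^esub> a) \<in> ?N #>\<^bsub>G\<^esub> a"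
        using G.rcos_self[OF that N.subgroup_axioms] by (rule someI)
      then show ?thesis by (auto simp: r_coset_def)
    qed
    obtain m n where mn: "m \<in> ?N" "(SOME x. x \<in> ?N #>\<^bsub>G\<^esub> a) = m \<otimes>\<^bsub>G\<^esub> a"
        "n \<in> ?N" "(SOME x. x \<in> ?N #>\<^bsub>G\<^esub> b) = n \<otimes>\<^bsub>G\<^esub> b"
      using rep ab by meson
    show ?thesis
      using mn ab by (simp add: \<beta>_def dev_mult_left dev_mult_right dev_derived_mult[OF C])
  qed
  have Q: "carrier ?Q = (\<lambda>x. ?N #>\<^bsub>G\<^esub> x) ` carrier G"
    by (simp add: ab_quot_def carrier_FactGroup)
  have Qm: "(?N #>\<^bsub>G\<^esub> x) \<otimes>\<^bsub>?Q\<^esub> (?N #>\<^bsub>G\<^esub> y) = ?N #>\<^bsub>G\<^esub> (x \<otimes>\<^bsub>G\<^esub> y)"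
    if "x \<in> carrier G" "y \<in> carrier G" for x y
    using that by (simp add: ab_quot_def N.rcos_sum)
  note gQ = tensor_sq_group(1)[OF G.is_group subgroup_B]
  obtain w where w: "w \<in> ext_hom (tensor ?Q ?Q) (H\<lparr>carrier := C\<rparr>)"
    and wp: "\<And>X Y. \<lbrakk>X \<in> carrier ?Q; Y \<in> carrier ?Q\<rbrakk> \<Longrightarrow> w (pure_tensor ?Q ?Q X Y) = \<beta> X Y"
  proof (rule tensor_universal[OF gQ gQ C, where \<beta> = \<beta>])
    show "\<beta> X Y \<in> carrier (H\<lparr>carrier := C\<rparr>)" if "X \<in> carrier ?Q" "Y \<in> carrier ?Q" for X Y
      using that by (auto simp: Q \<beta> dev_mem)
    show "\<beta> (X \<otimes>\<^bsub>?Q\<^esub> Y) Z = \<beta> X Z \<otimes>\<^bsub>H\<lparr>carrier := C\<rparr>\<^esub> \<beta> Y Z"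
      if "X \<in> carrier ?Q" "Y \<in> carrier ?Q" "Z \<in> carrier ?Q" for X Y Z
      using that by (auto simp: Q Qm \<beta> dev_mult_left)
    show "\<beta> X (Y \<otimes>\<^bsub>?Q\<^esub> Z) = \<beta> X Y \<otimes>\<^bsub>H\<lparr>carrier := C\<rparr>\<^esub> \<beta> X Z"
      if "X \<in> carrier ?Q" "Y \<in> carrier ?Q" "Z \<in> carrier ?Q" for X Y Z
      using that by (auto simp: Q Qm \<beta> dev_mult_right)
  qed (rule that)
  show ?thesis
  proof
    show "w \<in> ext_hom (tensor_sq (G, B)) (H\<lparr>carrier := C\<rparr>)"
      using w by (simp add: tensor_sq_def)
    show "w (class_tensor (G, B) a b) = d a b" if "a \<in> carrier G" "b \<in> carrier G" for a b
      using that wp by (simp add: class_tensor_def Q \<beta>)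
  qed
qed

lemma w_map:
  assumes C: "comm_group (H\<lparr>carrier := C\<rparr>)"
  shows w_map_in_ext_hom: "w_map (G, B) H f \<in> ext_hom (tensor_sq (G, B)) (H\<lparr>carrier := C\<rparr>)"
    and w_map_class_tensor: "\<And>a b. \<lbrakk>a \<in> carrier G; b \<in> carrier G\<rbrakk>
      \<Longrightarrow> w_map (G, B) H f (class_tensor (G, B) a b) = d a b"
proof -
  obtain w where w: "w \<in> ext_hom (tensor_sq (G, B)) (H\<lparr>carrier := C\<rparr>)"
    and wd: "\<And>a b. \<lbrakk>a \<in> carrier G; b \<in> carrier G\<rbrakk> \<Longrightarrow> w (class_tensor (G, B) a b) = d a b"
    using w_map_exists[OF C] by blast
  \<comment> \<open>the defining description quantifies over homomorphisms into all of \<open>H\<close>\<close>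
  have wH: "w \<in> ext_hom (tensor_sq (G, B)) H"
    using w C.mem_carrier by (auto simp: ext_hom_def hom_def Pi_iff)
  have "w_map (G, B) H f = w"
    unfolding w_map_def fst_conv
  proof (rule the_equality)
    fix v assume v: "v \<in> ext_hom (tensor_sq (G, B)) H \<and>
      (\<forall>a\<in>carrier G. \<forall>b\<in>carrier G. v (class_tensor (G, B) a b) = d a b)"
    show "v = w"
      by (rule tensor_sq_hom_eqI[OF G.is_group subgroup_B H.is_group]) (use v wH wd in auto)
  qed (use wH wd in auto)
  then show "w_map (G, B) H f \<in> ext_hom (tensor_sq (G, B)) (H\<lparr>carrier := C\<rparr>)"
    "\<And>a b. \<lbrakk>a \<in> carrier G; b \<in> carrier G\<rbrakk> \<Longrightarrow> w_map (G, B) H f (class_tensor (G, B) a b) = d a b"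
    using w wd by simp_all
qed

end

lemma tensor_sq_map_ident:
  assumes "group G" "subgroup B G"
  shows "tensor_sq_map (G, B) (G, B) (\<lambda>x\<in>carrier G. x) = (\<lambda>t\<in>carrier (tensor_sq (G, B)). t)"
  unfolding tensor_sq_map_def tensor_sq_def ab_quot_map_ident[OF assms]
  by (intro tensor_map_ident tensor_sq_group assms)

context quadratic_pair_map_compose
begin

lemma tensor_sq_map_compose:
  "tensor_sq_map (G, B) (K, E) fg
    = compose (carrier (tensor_sq (G, B))) (tensor_sq_map (H, C) (K, E) f) (tensor_sq_map (G, B) (H, C) g)"
  unfolding tensor_sq_map_def tensor_sq_def ab_quot_map_compose
  by (rule tensor_map_compose tensor_sq_group g.G.is_group g.H.is_group f.H.is_group
      g.subgroup_B f.subgroup_B f.subgroup_C g.ab_quot_map_in_ext_hom f.ab_quot_map_in_ext_hom)+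

end


section \<open>Categories\<close>

lemma category_full_subcat:
  assumes "category C" shows "category (full_subcat C P)"
proof -
  interpret C: category C by (rule assms)
  show ?thesis
    by unfold_locales
      (auto simp: full_subcat_def C.ident_mor C.comp_mor C.comp_ident_right C.comp_ident_left C.comp_assoc)
qed

lemma category_op_cat:
  assumes "category C" shows "category (op_cat C)"
proof -
  interpret C: category C by (rule assms)
  show ?thesis
    by unfold_locales
      (auto simp: op_cat_def C.ident_mor C.comp_mor C.comp_ident_right C.comp_ident_left C.comp_assoc)
qed

lemma category_prod_cat:
  assumes "category C" "category D" shows "category (C \<times>\<^sub>C D)"
proof -
  interpret C: category C by (rule assms)
  interpret D: category D by (rule assms)
  show ?thesis
    by unfold_locales
      (auto simp: prod_cat_def C.ident_mor C.comp_mor C.comp_ident_right C.comp_ident_left C.comp_assoc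
        D.ident_mor D.comp_mor D.comp_ident_right D.comp_ident_left D.comp_assoc)
qed

text \<open>A functor restricts to full subcategories of its source and target; the hypotheses only
  compare the structure, so that they also cover \<open>Ab \<times> Ab\<close> inside \<open>Ab \<times> Gr\<close>.\<close>

lemma is_functor_restrict:
  assumes F: "is_functor C D F" and C': "category C'" and D': "category D'"
    and C: "Obj C' \<subseteq> Obj C" "Mor C' = Mor C" "Ident C' = Ident C" "Comp C' = Comp C"
    and D: "Mor D' = Mor D" "Ident D' = Ident D" "Comp D' = Comp D"
    and obj: "\<And>X. X \<in> Obj C' \<Longrightarrow> fobj F X \<in> Obj D'"
  shows "is_functor C' D' F"
proof (intro is_functor.intro C' D')
  have "is_functor_axioms C D F"
    using F by (rule is_functor.axioms(3))
  then show "is_functor_axioms C' D' F"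
    using C(1) obj unfolding is_functor_axioms_def C(2-) D
    by (elim conjE, intro conjI allI impI) (simp_all add: subsetD)
qed

lemma category_Grp: "category Grp"
proof
  show "Ident Grp G \<in> Mor Grp G G" if "G \<in> Obj Grp" for G :: "'a monoid"
    using that ext_hom_ident by (auto simp: Grp_def)
  show "Comp Grp G H K g f \<in> Mor Grp G K"
    if "G \<in> Obj Grp" "f \<in> Mor Grp G H" "g \<in> Mor Grp H K" for G H K :: "'a monoid" and f g
    using that ext_hom_compose by (auto simp: Grp_def)
  fix G H K L :: "'a monoid" and f g h
  assume f: "f \<in> Mor Grp G H"
  then show "Comp Grp G G H f (Ident Grp G) = f" "Comp Grp G H H (Ident Grp H) f = f"
    by (auto simp: Grp_def ext_hom_def hom_def compose_Id Id_compose)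
  show "Comp Grp G H L (Comp Grp H K L h g) f = Comp Grp G K L h (Comp Grp G H K g f)"
    using f compose_assoc[of f "carrier G" "carrier H" h g] by (auto simp: Grp_def ext_hom_def hom_def)
qed

lemma category_Ab: "category Ab"
  unfolding Ab_def by (rule category_full_subcat[OF category_Grp])

lemma Mor_Ab: "Mor Ab = ext_hom" and Ident_Ab: "Ident Ab = (\<lambda>G. \<lambda>x\<in>carrier G. x)"
  and Comp_Ab: "Comp Ab = (\<lambda>G H K g f. compose (carrier G) g f)"
  and Obj_Ab: "Obj Ab = {G. comm_group G}"
  by (auto simp: Ab_def full_subcat_def Grp_def comm_group_def)

lemma Obj_QP: "(G, B) \<in> Obj QP \<longleftrightarrow> group G \<and> subgroup B G"
  and Ident_QP: "Ident QP (G, B) = (\<lambda>x\<in>carrier G. x)"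
  and Comp_QP: "Comp QP (G, B) Y Z g f = compose (carrier G) g f"
  by (simp_all add: QP_def)

lemma QP_mor_imp:
  assumes "(G, B) \<in> Obj QP" "(H, C) \<in> Obj QP" "f \<in> Mor QP (G, B) (H, C)"
  shows "quadratic_pair_map G H B C f"
  using assms by (simp add: quadratic_pair_map_def quadratic_pair_map_axioms_def Obj_QP)

lemma QP_mor_compose:
  assumes "(G, B) \<in> Obj QP" "(H, C) \<in> Obj QP" "(K, E) \<in> Obj QP"
    and "g \<in> Mor QP (G, B) (H, C)" "f \<in> Mor QP (H, C) (K, E)"
  shows "quadratic_pair_map_compose G H K B C E g f"
  using assms by (simp add: quadratic_pair_map_compose_def QP_mor_imp)

lemma category_QP: "category QP"
proof
  fix W X Y Z :: "'a gpair" and f g h :: "'a \<Rightarrow> 'a"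
  obtain G B where W: "W = (G, B)" by fastforce
  obtain H C where X: "X = (H, C)" by fastforce
  obtain K E where Y: "Y = (K, E)" by fastforce
  show "Ident QP W \<in> Mor QP W W" if "W \<in> Obj QP"
    using that by (simp add: W Obj_QP Ident_QP ident_in_QP)
  show "Comp QP W X Y g f \<in> Mor QP W Y"
    if "W \<in> Obj QP" "X \<in> Obj QP" "Y \<in> Obj QP" "f \<in> Mor QP W X" "g \<in> Mor QP X Y"
    using quadratic_pair_map_compose.compose_in_QP[OF QP_mor_compose] that
    by (simp add: W X Y Comp_QP)
  assume f: "f \<in> Mor QP W X"
  have f1: "f \<in> carrier G \<rightarrow> carrier H"
    using f by (simp add: W X QP_def PiE_iff)
  have f2: "f \<in> extensional (carrier G)"
    using f by (simp add: W X QP_def PiE_iff)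
  show "Comp QP W W X f (Ident QP W) = f"
    by (simp add: W Comp_QP Ident_QP compose_Id[OF f1 f2])
  show "Comp QP W X X (Ident QP X) f = f"
    by (simp add: W X Comp_QP Ident_QP Id_compose[OF f1 f2])
  show "Comp QP W X Z (Comp QP X Y Z h g) f = Comp QP W Y Z h (Comp QP W X Y g f)"
    using compose_assoc[OF f1, of h g] by (simp add: W X Comp_QP Y)
qed

lemma AQP_simps: "Mor AQP = Mor QP" "Ident AQP = Ident QP" "Comp AQP = Comp QP"
    "(G, B) \<in> Obj AQP \<longleftrightarrow> (G, B) \<in> Obj QP \<and> comm_group (G\<lparr>carrier := B\<rparr>)"
  and NQP_simps: "Mor NQP = Mor QP" "Ident NQP = Ident QP" "Comp NQP = Comp QP"
    "(G, B) \<in> Obj NQP \<longleftrightarrow> (G, B) \<in> Obj QP \<and> B \<lhd> G"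
  and CP_simps: "Mor CP = Mor QP" "Ident CP = Ident QP" "Comp CP = Comp QP"
    "(G, B) \<in> Obj CP \<longleftrightarrow> (G, B) \<in> Obj QP \<and>
      (\<forall>b\<in>B. \<forall>x\<in>carrier G. b \<otimes>\<^bsub>G\<^esub> x = x \<otimes>\<^bsub>G\<^esub> b) \<and> derived G (carrier G) \<subseteq> B"
  by (simp_all add: AQP_def NQP_def CP_def full_subcat_def)

lemma category_subcats: "category AQP" "category NQP" "category CP"
  unfolding AQP_def NQP_def CP_def by (rule category_full_subcat[OF category_QP])+


section \<open>The functors \<open>Gr\<close>, \<open>Gr\<^sub>N\<close>, \<open>Gr\<^sub>A\<close> and \<open>Gr\<^sub>C\<close>\<close>

lemma is_functor_Gr: "is_functor QP (Ab \<times>\<^sub>C Grp) Gr_ab"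
proof (intro is_functor.intro is_functor_axioms.intro category_QP category_prod_cat category_Ab category_Grp)
  fix X Y Z :: "'a gpair" and f g :: "'a \<Rightarrow> 'a"
  obtain G B where X: "X = (G, B)" by fastforce
  obtain H C where Y: "Y = (H, C)" by fastforce
  obtain K E where Z: "Z = (K, E)" by fastforce
  note defs = X Y Z Gr_ab_def prod_cat_def Obj_Ab Mor_Ab Ident_Ab Comp_Ab Grp_def Comp_QP Ident_QP
  assume XO: "X \<in> Obj QP"
  then have G: "group G" "subgroup B G"
    by (simp_all add: X Obj_QP)
  show "fobj Gr_ab X \<in> Obj (Ab \<times>\<^sub>C Grp)"
    using G by (simp add: defs comm_group_ab_quot subgroup.subgroup_is_group)
  show "fmor Gr_ab X X (Ident QP X) = Ident (Ab \<times>\<^sub>C Grp) (fobj Gr_ab X)"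
    using G by (simp add: defs ab_quot_map_ident Int_absorb1 subgroup.subset)
  assume YO: "Y \<in> Obj QP" and f: "f \<in> Mor QP X Y"
  interpret f: quadratic_pair_map G H B C f
    using QP_mor_imp XO YO f by (simp add: X Y)
  show "fmor Gr_ab X Y f \<in> Mor (Ab \<times>\<^sub>C Grp) (fobj Gr_ab X) (fobj Gr_ab Y)"
    by (simp add: defs f.ab_quot_map_in_ext_hom f.restrict_hom)
  assume ZO: "Z \<in> Obj QP" and g: "g \<in> Mor QP Y Z"
  interpret fg: quadratic_pair_map_compose G H K B C E f g
    using QP_mor_compose XO YO ZO f g by (simp add: X Y Z)
  show "fmor Gr_ab X Z (Comp QP X Y Z g f)
      = Comp (Ab \<times>\<^sub>C Grp) (fobj Gr_ab X) (fobj Gr_ab Y) (fobj Gr_ab Z) (fmor Gr_ab Y Z g) (fmor Gr_ab X Y f)"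
    by (simp add: defs fg.ab_quot_map_compose fg.restrict_compose)
qed

lemma (in quadratic_pair_map) hom_modulo_pair: "C \<lhd> H \<Longrightarrow> hom_modulo G B H C f"
  by (rule hom_modulo_normal(2)) (auto simp: maps_B)

lemma is_functor_Gr_N: "is_functor NQP (Grp \<times>\<^sub>C Grp) Gr_normal"
proof (intro is_functor.intro is_functor_axioms.intro category_subcats category_prod_cat category_Grp)
  fix X Y Z :: "'a gpair" and f g :: "'a \<Rightarrow> 'a"
  obtain G B where X: "X = (G, B)" by fastforce
  obtain H C where Y: "Y = (H, C)" by fastforce
  obtain K E where Z: "Z = (K, E)" by fastforce
  note defs = X Y Z Gr_normal_def prod_cat_def Grp_def NQP_simps Comp_QP Ident_QP
  assume XO: "X \<in> Obj NQP"
  then have G: "group G" "subgroup B G" "B \<lhd> G"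
    by (simp_all add: X Obj_QP NQP_simps)
  show "fobj Gr_normal X \<in> Obj (Grp \<times>\<^sub>C Grp)"
    using G by (simp add: defs normal.factorgroup_is_group subgroup.subgroup_is_group)
  show "fmor Gr_normal X X (Ident NQP X) = Ident (Grp \<times>\<^sub>C Grp) (fobj Gr_normal X)"
    using G by (simp add: defs quot_map_ident Int_absorb1 subgroup.subset)
  assume YO: "Y \<in> Obj NQP" and f: "f \<in> Mor NQP X Y"
  interpret f: quadratic_pair_map G H B C f
    using XO YO f by (intro QP_mor_imp) (simp_all add: X Y NQP_simps)
  have H: "C \<lhd> H" using YO by (simp add: Y NQP_simps)
  show "fmor Gr_normal X Y f \<in> Mor (Grp \<times>\<^sub>C Grp) (fobj Gr_normal X) (fobj Gr_normal Y)"
    using G H by (simp add: defs quot_map_in_ext_hom f.hom_modulo_pair f.restrict_hom)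
  assume ZO: "Z \<in> Obj NQP" and g: "g \<in> Mor NQP Y Z"
  interpret fg: quadratic_pair_map_compose G H K B C E f g
    using XO YO ZO f g by (intro QP_mor_compose) (simp_all add: X Y Z NQP_simps)
  have K: "E \<lhd> K" using ZO by (simp add: Z NQP_simps)
  show "fmor Gr_normal X Z (Comp NQP X Y Z g f)
      = Comp (Grp \<times>\<^sub>C Grp) (fobj Gr_normal X) (fobj Gr_normal Y) (fobj Gr_normal Z)
          (fmor Gr_normal Y Z g) (fmor Gr_normal X Y f)"
    using quot_map_compose[OF G(3) H K f.hom_modulo_pair[OF H] fg.f.hom_modulo_pair[OF K]]
    by (simp add: defs fg.restrict_compose)
qed

lemma is_functor_Gr_A: "is_functor AQP (Ab \<times>\<^sub>C Ab) Gr_ab"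
proof (rule is_functor_restrict[OF is_functor_Gr category_subcats(1) category_prod_cat[OF category_Ab category_Ab]])
  show "fobj Gr_ab X \<in> Obj (Ab \<times>\<^sub>C Ab)" if "X \<in> Obj AQP" for X :: "'a gpair"
    using that by (cases X) (auto simp: AQP_simps Obj_QP Gr_ab_def prod_cat_def Obj_Ab comm_group_ab_quot)
qed (auto simp: AQP_simps prod_cat_def Mor_Ab Ident_Ab Comp_Ab Grp_def)

lemma central_pair:
  assumes "(G, B) \<in> Obj CP"
  shows "B \<lhd> G" "comm_group (G Mod B)" "comm_group (G\<lparr>carrier := B\<rparr>)"
proof -
  interpret G: group G using assms by (simp add: CP_simps Obj_QP)
  interpret B: subgroup B G using assms by (simp add: CP_simps Obj_QP)
  have c: "b \<otimes>\<^bsub>G\<^esub> x = x \<otimes>\<^bsub>G\<^esub> b" if "b \<in> B" "x \<in> carrier G" for b x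
    using assms that unfolding CP_simps by blast
  show N: "B \<lhd> G"
  proof (rule G.normal_invI[OF B.subgroup_axioms])
    fix x h assume xh: "x \<in> carrier G" "h \<in> B"
    then have "x \<otimes>\<^bsub>G\<^esub> h \<otimes>\<^bsub>G\<^esub> inv\<^bsub>G\<^esub> x = h"
      by (simp add: c[OF xh(2,1), symmetric] G.m_assoc)
    then show "x \<otimes>\<^bsub>G\<^esub> h \<otimes>\<^bsub>G\<^esub> inv\<^bsub>G\<^esub> x \<in> B"
      using xh by simp
  qed
  show "comm_group (G Mod B)"
    using comm_group_FactGroupI[OF N] assms by (simp add: CP_simps)
  show "comm_group (G\<lparr>carrier := B\<rparr>)"
    by (rule group.group_comm_groupI[OF B.subgroup_is_group[OF G.is_group]]) (simp add: c)
qed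

lemma is_functor_Gr_C: "is_functor CP (Ab \<times>\<^sub>C Ab) Gr_normal"
proof (rule is_functor_restrict[OF is_functor_Gr_N category_subcats(3) category_prod_cat[OF category_Ab category_Ab]])
  show "Obj CP \<subseteq> Obj (NQP :: ('a gpair, 'a \<Rightarrow> 'a) category)"
    using central_pair(1) by (auto simp: NQP_simps) (simp_all add: CP_simps)
  show "fobj Gr_normal X \<in> Obj (Ab \<times>\<^sub>C Ab)" if "X \<in> Obj CP" for X :: "'a gpair"
    using that central_pair(2,3) by (cases X) (auto simp: Gr_normal_def prod_cat_def Obj_Ab)
qed (auto simp: NQP_simps CP_simps prod_cat_def Mor_Ab Ident_Ab Comp_Ab Grp_def)


section \<open>The bifunctor \<open>D\<close>\<close>

lemma fobj_Dbifun: "fobj Dbifun (X, (H, C)) = hom_group (tensor_sq X) (H\<lparr>carrier := C\<rparr>)"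
  by (simp add: Dbifun_def)

lemma carrier_hom_group: "carrier (hom_group A C) = ext_hom A C"
  by (simp add: hom_group_def)

text \<open>\<open>D(g, f)(u)\<close> sends \<open>t\<close> to \<open>f (u ((g \<otimes> g) t))\<close>, where \<open>g \<otimes> g\<close> stands for the tensor square
  of the map induced by \<open>g\<close>. The restriction of \<open>f\<close> to \<open>C\<close> disappears, as \<open>u\<close> takes its
  values in \<open>C\<close>.\<close>

lemma Dbifun_value:
  assumes g: "quadratic_pair_map G\<^sub>1 G B\<^sub>1 B g"
    and u: "u \<in> ext_hom (tensor_sq (G, B)) (H\<lparr>carrier := C\<rparr>)"
    and t: "t \<in> carrier (tensor_sq (G\<^sub>1, B\<^sub>1))"
  shows "fmor Dbifun ((G, B), (H, C)) ((G\<^sub>1, B\<^sub>1), (H\<^sub>1, C\<^sub>1)) (g, f) u t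
    = f (u (tensor_sq_map (G\<^sub>1, B\<^sub>1) (G, B) g t))"
  using ext_homD(3)[OF u, of "tensor_sq_map (G\<^sub>1, B\<^sub>1) (G, B) g t"]
    ext_homD(3)[OF quadratic_pair_map.tensor_sq_map_in_ext_hom[OF g] t] u t
  by (simp add: Dbifun_def carrier_hom_group compose_eq)

lemma Dbifun_value_ext_hom:
  assumes g: "quadratic_pair_map G\<^sub>1 G B\<^sub>1 B g" and f: "quadratic_pair_map H H\<^sub>1 C C\<^sub>1 f"
    and u: "u \<in> ext_hom (tensor_sq (G, B)) (H\<lparr>carrier := C\<rparr>)"
  shows "fmor Dbifun ((G, B), (H, C)) ((G\<^sub>1, B\<^sub>1), (H\<^sub>1, C\<^sub>1)) (g, f) u
    \<in> ext_hom (tensor_sq (G\<^sub>1, B\<^sub>1)) (H\<^sub>1\<lparr>carrier := C\<^sub>1\<rparr>)"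
proof -
  interpret g: quadratic_pair_map G\<^sub>1 G B\<^sub>1 B g by (rule g)
  interpret f: quadratic_pair_map H H\<^sub>1 C C\<^sub>1 f by (rule f)
  note T = tensor_sq_group(2)[OF g.G.is_group g.subgroup_B]
  show ?thesis
    using ext_hom_compose[OF T ext_hom_compose[OF T g.tensor_sq_map_in_ext_hom u] f.restrict_hom] u
    by (simp add: Dbifun_def carrier_hom_group)
qed

text \<open>\<open>D(g, f)\<close> is additive in \<open>u\<close> because \<open>f\<close> is a homomorphism on \<open>C\<close>.\<close>

lemma Dbifun_mor:
  assumes g: "quadratic_pair_map G\<^sub>1 G B\<^sub>1 B g" and f: "quadratic_pair_map H H\<^sub>1 C C\<^sub>1 f"
    and C: "comm_group (H\<lparr>carrier := C\<rparr>)"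
  shows "fmor Dbifun ((G, B), (H, C)) ((G\<^sub>1, B\<^sub>1), (H\<^sub>1, C\<^sub>1)) (g, f)
    \<in> ext_hom (hom_group (tensor_sq (G, B)) (H\<lparr>carrier := C\<rparr>))
        (hom_group (tensor_sq (G\<^sub>1, B\<^sub>1)) (H\<^sub>1\<lparr>carrier := C\<^sub>1\<rparr>))"
    (is "?\<phi> \<in> ext_hom ?A ?A\<^sub>1")
proof (rule ext_homI)
  interpret g: quadratic_pair_map G\<^sub>1 G B\<^sub>1 B g by (rule g)
  interpret f: quadratic_pair_map H H\<^sub>1 C C\<^sub>1 f by (rule f)
  interpret A: comm_group ?A
    by (rule comm_group_hom_group[OF tensor_sq_group(2)[OF g.H.is_group g.subgroup_C] C])
  show "?\<phi> \<in> extensional (carrier ?A)"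
    by (simp add: Dbifun_def)
  show "?\<phi> u \<in> carrier ?A\<^sub>1" if "u \<in> carrier ?A" for u
    using that Dbifun_value_ext_hom[OF g f] by (simp add: carrier_hom_group)
  fix u v assume uv: "u \<in> carrier ?A" "v \<in> carrier ?A"
  then have uv': "u \<in> ext_hom (tensor_sq (G, B)) (H\<lparr>carrier := C\<rparr>)" "v \<in> ext_hom (tensor_sq (G, B)) (H\<lparr>carrier := C\<rparr>)"
    "u \<otimes>\<^bsub>?A\<^esub> v \<in> ext_hom (tensor_sq (G, B)) (H\<lparr>carrier := C\<rparr>)"
    using A.m_closed[OF uv] by (simp_all add: carrier_hom_group)
  show "?\<phi> (u \<otimes>\<^bsub>?A\<^esub> v) = ?\<phi> u \<otimes>\<^bsub>?A\<^sub>1\<^esub> ?\<phi> v"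
  proof (rule extensionalityI)
    show "?\<phi> (u \<otimes>\<^bsub>?A\<^esub> v) \<in> extensional (carrier (tensor_sq (G\<^sub>1, B\<^sub>1)))"
      using Dbifun_value_ext_hom[OF g f uv'(3)] by (rule ext_homD)
    show "?\<phi> u \<otimes>\<^bsub>?A\<^sub>1\<^esub> ?\<phi> v \<in> extensional (carrier (tensor_sq (G\<^sub>1, B\<^sub>1)))"
      by (simp add: hom_group_def)
    fix t assume t: "t \<in> carrier (tensor_sq (G\<^sub>1, B\<^sub>1))"
    let ?s = "tensor_sq_map (G\<^sub>1, B\<^sub>1) (G, B) g t"
    have s: "?s \<in> carrier (tensor_sq (G, B))"
      by (rule ext_homD(3)[OF g.tensor_sq_map_in_ext_hom t])
    have "u ?s \<in> C" "v ?s \<in> C"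
      using ext_homD(3)[OF uv'(1) s] ext_homD(3)[OF uv'(2) s] by simp_all
    then have "f (u ?s \<otimes>\<^bsub>H\<^esub> v ?s) = f (u ?s) \<otimes>\<^bsub>H\<^sub>1\<^esub> f (v ?s)"
      by (simp add: f.map_mult_B)
    then show "?\<phi> (u \<otimes>\<^bsub>?A\<^esub> v) t = (?\<phi> u \<otimes>\<^bsub>?A\<^sub>1\<^esub> ?\<phi> v) t"
      unfolding Dbifun_value[OF g uv'(3) t]
      using s t by (simp add: hom_group_def Dbifun_value[OF g uv'(1) t] Dbifun_value[OF g uv'(2) t])
  qed
qed

lemma Dbifun_ident:
  assumes G: "group G" "subgroup B G" and H: "group H" "subgroup C H"
  shows "fmor Dbifun ((G, B), (H, C)) ((G, B), (H, C)) (\<lambda>x\<in>carrier G. x, \<lambda>x\<in>carrier H. x)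
    = (\<lambda>u\<in>carrier (hom_group (tensor_sq (G, B)) (H\<lparr>carrier := C\<rparr>)). u)" (is "?\<phi> = ?id")
proof (rule extensionalityI)
  have g: "quadratic_pair_map G G B B (\<lambda>x\<in>carrier G. x)"
    by (rule quadratic_pair_map_ident[OF G])
  have f: "quadratic_pair_map H H C C (\<lambda>x\<in>carrier H. x)"
    by (rule quadratic_pair_map_ident[OF H])
  show "?\<phi> \<in> extensional (carrier (hom_group (tensor_sq (G, B)) (H\<lparr>carrier := C\<rparr>)))"
    by (simp add: Dbifun_def)
  show "?id \<in> extensional (carrier (hom_group (tensor_sq (G, B)) (H\<lparr>carrier := C\<rparr>)))"
    by simp
  fix u assume uc: "u \<in> carrier (hom_group (tensor_sq (G, B)) (H\<lparr>carrier := C\<rparr>))"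
  then have u: "u \<in> ext_hom (tensor_sq (G, B)) (H\<lparr>carrier := C\<rparr>)"
    by (simp add: carrier_hom_group)
  have "?\<phi> u = u"
  proof (rule extensionalityI[OF ext_homD(1)[OF Dbifun_value_ext_hom[OF g f u]] ext_homD(1)[OF u]])
    fix t assume t: "t \<in> carrier (tensor_sq (G, B))"
    then show "?\<phi> u t = u t"
      using ext_homD(3)[OF u t] subgroup.mem_carrier[OF H(2)]
      by (simp add: Dbifun_value[OF g u t] tensor_sq_map_ident[OF G])
  qed
  then show "?\<phi> u = ?id u"
    using uc by simp
qed

lemma Dbifun_compose:
  assumes g: "quadratic_pair_map_compose G\<^sub>2 G\<^sub>1 G B\<^sub>2 B\<^sub>1 B g' g"
    and f: "quadratic_pair_map_compose H H\<^sub>1 H\<^sub>2 C C\<^sub>1 C\<^sub>2 f f'"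
  shows "fmor Dbifun ((G, B), (H, C)) ((G\<^sub>2, B\<^sub>2), (H\<^sub>2, C\<^sub>2)) (compose (carrier G\<^sub>2) g g', compose (carrier H) f' f)
    = compose (carrier (hom_group (tensor_sq (G, B)) (H\<lparr>carrier := C\<rparr>)))
        (fmor Dbifun ((G\<^sub>1, B\<^sub>1), (H\<^sub>1, C\<^sub>1)) ((G\<^sub>2, B\<^sub>2), (H\<^sub>2, C\<^sub>2)) (g', f'))
        (fmor Dbifun ((G, B), (H, C)) ((G\<^sub>1, B\<^sub>1), (H\<^sub>1, C\<^sub>1)) (g, f))" (is "?\<chi> = compose _ ?\<psi> ?\<phi>")
proof (rule extensionalityI)
  interpret g: quadratic_pair_map_compose G\<^sub>2 G\<^sub>1 G B\<^sub>2 B\<^sub>1 B g' g by (rule g)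
  interpret f: quadratic_pair_map_compose H H\<^sub>1 H\<^sub>2 C C\<^sub>1 C\<^sub>2 f f' by (rule f)
  note ax = g.g.quadratic_pair_map_axioms g.f.quadratic_pair_map_axioms g.fg.quadratic_pair_map_axioms
    f.g.quadratic_pair_map_axioms f.f.quadratic_pair_map_axioms f.fg.quadratic_pair_map_axioms
  show "?\<chi> \<in> extensional (carrier (hom_group (tensor_sq (G, B)) (H\<lparr>carrier := C\<rparr>)))"
    by (simp add: Dbifun_def)
  show "compose (carrier (hom_group (tensor_sq (G, B)) (H\<lparr>carrier := C\<rparr>))) ?\<psi> ?\<phi>
      \<in> extensional (carrier (hom_group (tensor_sq (G, B)) (H\<lparr>carrier := C\<rparr>)))"
    by simp
  fix u assume uc: "u \<in> carrier (hom_group (tensor_sq (G, B)) (H\<lparr>carrier := C\<rparr>))"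
  then have u: "u \<in> ext_hom (tensor_sq (G, B)) (H\<lparr>carrier := C\<rparr>)"
    by (simp add: carrier_hom_group)
  note \<phi>u = Dbifun_value_ext_hom[OF ax(2,4) u]
  have "?\<chi> u = ?\<psi> (?\<phi> u)"
  proof (rule extensionalityI[OF ext_homD(1)[OF Dbifun_value_ext_hom[OF ax(3,6) u]]
        ext_homD(1)[OF Dbifun_value_ext_hom[OF ax(1,5) \<phi>u]]])
    fix t assume t: "t \<in> carrier (tensor_sq (G\<^sub>2, B\<^sub>2))"
    have t': "tensor_sq_map (G\<^sub>2, B\<^sub>2) (G\<^sub>1, B\<^sub>1) g' t \<in> carrier (tensor_sq (G\<^sub>1, B\<^sub>1))"
      by (rule ext_homD(3)[OF g.g.tensor_sq_map_in_ext_hom t])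
    have "u (tensor_sq_map (G\<^sub>1, B\<^sub>1) (G, B) g (tensor_sq_map (G\<^sub>2, B\<^sub>2) (G\<^sub>1, B\<^sub>1) g' t)) \<in> C"
      using ext_homD(3)[OF u ext_homD(3)[OF g.f.tensor_sq_map_in_ext_hom t']] by simp
    then show "?\<chi> u t = ?\<psi> (?\<phi> u) t"
      using t by (simp add: Dbifun_value[OF ax(3) u t] Dbifun_value[OF ax(1) \<phi>u t]
          Dbifun_value[OF ax(2) u t'] g.tensor_sq_map_compose compose_eq)
  qed
  then show "?\<chi> u = compose (carrier (hom_group (tensor_sq (G, B)) (H\<lparr>carrier := C\<rparr>))) ?\<psi> ?\<phi> u"
    using uc by (simp add: compose_eq)
qed

lemma is_functor_Dbifun: "is_functor (op_cat AQP \<times>\<^sub>C AQP) Ab Dbifun"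
proof (intro is_functor.intro is_functor_axioms.intro category_subcats category_prod_cat category_op_cat
    category_Ab)
  fix X Y Z :: "'a gpair \<times> 'a gpair" and \<phi> \<psi> :: "('a \<Rightarrow> 'a) \<times> ('a \<Rightarrow> 'a)"
  obtain G B H C where X: "X = ((G, B), (H, C))" by (cases X) auto
  obtain G\<^sub>1 B\<^sub>1 H\<^sub>1 C\<^sub>1 where Y: "Y = ((G\<^sub>1, B\<^sub>1), (H\<^sub>1, C\<^sub>1))" by (cases Y) auto
  obtain G\<^sub>2 B\<^sub>2 H\<^sub>2 C\<^sub>2 where Z: "Z = ((G\<^sub>2, B\<^sub>2), (H\<^sub>2, C\<^sub>2))" by (cases Z) auto
  obtain g f where \<phi>: "\<phi> = (g, f)" by fastforce
  obtain g' f' where \<psi>: "\<psi> = (g', f')" by fastforce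
  note defs = X Y Z \<phi> \<psi> op_cat_def prod_cat_def AQP_simps Ident_QP Comp_QP
    Obj_Ab Mor_Ab Ident_Ab Comp_Ab fobj_Dbifun
  assume XO: "X \<in> Obj (op_cat AQP \<times>\<^sub>C AQP)"
  then have G: "group G" "subgroup B G" and H: "group H" "subgroup C H"
    and C: "comm_group (H\<lparr>carrier := C\<rparr>)"
    by (auto simp: defs Obj_QP)
  show "fobj Dbifun X \<in> Obj Ab"
    by (simp add: defs comm_group_hom_group tensor_sq_group G C)
  show "fmor Dbifun X X (Ident (op_cat AQP \<times>\<^sub>C AQP) X) = Ident Ab (fobj Dbifun X)"
    by (simp add: defs Dbifun_ident G H)
  assume YO: "Y \<in> Obj (op_cat AQP \<times>\<^sub>C AQP)" and \<phi>m: "\<phi> \<in> Mor (op_cat AQP \<times>\<^sub>C AQP) X Y"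
  have "quadratic_pair_map G\<^sub>1 G B\<^sub>1 B g" "quadratic_pair_map H H\<^sub>1 C C\<^sub>1 f"
    using XO YO \<phi>m by (auto simp: defs QP_mor_imp)
  then show "fmor Dbifun X Y \<phi> \<in> Mor Ab (fobj Dbifun X) (fobj Dbifun Y)"
    using Dbifun_mor C by (simp add: defs)
  assume ZO: "Z \<in> Obj (op_cat AQP \<times>\<^sub>C AQP)" and \<psi>m: "\<psi> \<in> Mor (op_cat AQP \<times>\<^sub>C AQP) Y Z"
  have "quadratic_pair_map_compose G\<^sub>2 G\<^sub>1 G B\<^sub>2 B\<^sub>1 B g' g"
    "quadratic_pair_map_compose H H\<^sub>1 H\<^sub>2 C C\<^sub>1 C\<^sub>2 f f'"
    using XO YO ZO \<phi>m \<psi>m by (auto simp: defs intro: QP_mor_compose)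
  then show "fmor Dbifun X Z (Comp (op_cat AQP \<times>\<^sub>C AQP) X Y Z \<psi> \<phi>)
      = Comp Ab (fobj Dbifun X) (fobj Dbifun Y) (fobj Dbifun Z) (fmor Dbifun Y Z \<psi>) (fmor Dbifun X Y \<phi>)"
    by (simp add: defs Dbifun_compose)
qed


section \<open>The derivation\<close>

text \<open>Both sides are homomorphisms on \<open>G/G'B \<otimes> G/G'B\<close>; on the class of \<open>a \<otimes> b\<close> the
  equation is the chain rule for deviations.\<close>

lemma (in quadratic_pair_map_compose) w_map_derivation:
  assumes C: "comm_group (H\<lparr>carrier := C\<rparr>)" and E: "comm_group (K\<lparr>carrier := E\<rparr>)"
  shows "w_map (G, B) K fg
    = fmor Dbifun ((G, B), (H, C)) ((G, B), (K, E)) (\<lambda>x\<in>carrier G. x, f) (w_map (G, B) H g)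
      \<otimes>\<^bsub>hom_group (tensor_sq (G, B)) (K\<lparr>carrier := E\<rparr>)\<^esub>
      fmor Dbifun ((H, C), (K, E)) ((G, B), (K, E)) (g, \<lambda>x\<in>carrier K. x) (w_map (H, C) K f)"
    (is "?w = ?u \<otimes>\<^bsub>?A\<^esub> ?v")
proof (rule tensor_sq_hom_eqI[OF g.G.is_group g.subgroup_B])
  note gm = g.quadratic_pair_map_axioms and fm = f.quadratic_pair_map_axioms
  note wg = g.w_map_in_ext_hom[OF C] and wf = f.w_map_in_ext_hom[OF E]
  have idG: "quadratic_pair_map G G B B (\<lambda>x\<in>carrier G. x)"
    by (rule quadratic_pair_map_ident[OF g.G.is_group g.subgroup_B])
  have idK: "quadratic_pair_map K K E E (\<lambda>x\<in>carrier K. x)"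
    by (rule quadratic_pair_map_ident[OF f.H.is_group f.subgroup_C])
  interpret A: comm_group ?A
    by (rule comm_group_hom_group[OF tensor_sq_group(2)[OF g.G.is_group g.subgroup_B] E])
  have "?u \<in> carrier ?A" "?v \<in> carrier ?A"
    using Dbifun_value_ext_hom[OF idG fm wg] Dbifun_value_ext_hom[OF gm idK wf]
    by (simp_all add: carrier_hom_group)
  then show "?u \<otimes>\<^bsub>?A\<^esub> ?v \<in> ext_hom (tensor_sq (G, B)) (K\<lparr>carrier := E\<rparr>)"
    using A.m_closed by (simp add: carrier_hom_group)
  show "?w \<in> ext_hom (tensor_sq (G, B)) (K\<lparr>carrier := E\<rparr>)"
    by (rule fg.w_map_in_ext_hom[OF E])
  show "group (K\<lparr>carrier := E\<rparr>)"
    using E by (simp add: comm_group_def)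
  fix a b assume ab: "a \<in> carrier G" "b \<in> carrier G"
  let ?t = "class_tensor (G, B) a b"
  have t: "?t \<in> carrier (tensor_sq (G, B))"
    by (rule class_tensor_closed[OF g.G.is_group g.subgroup_B ab])
  have "?u ?t = f (g.d a b)"
    using t ab by (simp add: Dbifun_value[OF idG wg t] g.w_map_class_tensor[OF C]
        tensor_sq_map_ident[OF g.G.is_group g.subgroup_B])
  moreover have "?v ?t = f.d (g a) (g b)"
    using ab by (simp add: Dbifun_value[OF gm wf t] g.tensor_sq_map_class_tensor f.w_map_class_tensor[OF E])
  ultimately show "?w ?t = (?u \<otimes>\<^bsub>?A\<^esub> ?v) ?t"
    using ab t by (simp add: fg.w_map_class_tensor[OF E] dev_compose hom_group_def)
qed

theorem proposition1p14:
  shows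
  "is_functor (QP :: ('a gpair, 'a \<Rightarrow> 'a) category) (Ab \<times>\<^sub>C Grp) Gr_ab \<and>
   is_functor (NQP :: ('a gpair, 'a \<Rightarrow> 'a) category) (Grp \<times>\<^sub>C Grp) Gr_normal \<and>
   is_functor (AQP :: ('a gpair, 'a \<Rightarrow> 'a) category) (Ab \<times>\<^sub>C Ab) Gr_ab \<and>
   is_functor (CP :: ('a gpair, 'a \<Rightarrow> 'a) category) (Ab \<times>\<^sub>C Ab) Gr_normal \<and>
   (\<forall>(G :: 'a monoid) B (H :: 'a monoid) C f.
      (G, B) \<in> Obj QP \<longrightarrow> (H, C) \<in> Obj QP \<longrightarrow> f \<in> Mor QP (G, B) (H, C) \<longrightarrow>
      (\<forall>x\<in>carrier G. ab_quot_map (G, B) (H, C) f (derived_mult (G, B) #>\<^bsub>G\<^esub> x)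
                     = derived_mult (H, C) #>\<^bsub>H\<^esub> f x)) \<and>
   (\<forall>(G :: 'a monoid) B (H :: 'a monoid) C f.
      (G, B) \<in> Obj NQP \<longrightarrow> (H, C) \<in> Obj NQP \<longrightarrow> f \<in> Mor NQP (G, B) (H, C) \<longrightarrow>
      (\<forall>x\<in>carrier G. quot_map G B H C f (B #>\<^bsub>G\<^esub> x) = C #>\<^bsub>H\<^esub> f x)) \<and>
   is_functor (op_cat AQP \<times>\<^sub>C (AQP :: ('a gpair, 'a \<Rightarrow> 'a) category)) Ab Dbifun \<and>
   (\<forall>(G :: 'a monoid) B (H :: 'a monoid) C f.
      (G, B) \<in> Obj AQP \<longrightarrow> (H, C) \<in> Obj AQP \<longrightarrow> f \<in> Mor AQP (G, B) (H, C) \<longrightarrow>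
      w_map (G, B) H f \<in> carrier (fobj Dbifun ((G, B), (H, C))) \<and>
      (\<forall>a\<in>carrier G. \<forall>b\<in>carrier G.
         w_map (G, B) H f (class_tensor (G, B) a b) = dev G H f a b)) \<and>
   (\<forall>(K :: 'a monoid) A (G :: 'a monoid) B (H :: 'a monoid) C g f.
      (K, A) \<in> Obj AQP \<longrightarrow> (G, B) \<in> Obj AQP \<longrightarrow> (H, C) \<in> Obj AQP \<longrightarrow>
      g \<in> Mor AQP (K, A) (G, B) \<longrightarrow> f \<in> Mor AQP (G, B) (H, C) \<longrightarrow>
      w_map (K, A) H (Comp AQP (K, A) (G, B) (H, C) f g)
      = fmor Dbifun ((K, A), (G, B)) ((K, A), (H, C)) (Ident AQP (K, A), f) (w_map (K, A) G g)
        \<otimes>\<^bsub>fobj Dbifun ((K, A), (H, C))\<^esub>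
        fmor Dbifun ((G, B), (H, C)) ((K, A), (H, C)) (g, Ident AQP (H, C)) (w_map (G, B) H f))"
proof (intro conjI allI impI ballI is_functor_Gr is_functor_Gr_N is_functor_Gr_A is_functor_Gr_C
    is_functor_Dbifun)
  fix G H :: "'a monoid" and B C f
  assume "(G, B) \<in> Obj QP" "(H, C) \<in> Obj QP" "f \<in> Mor QP (G, B) (H, C)"
  then interpret quadratic_pair_map G H B C f by (rule QP_mor_imp)
  show "ab_quot_map (G, B) (H, C) f (derived_mult (G, B) #>\<^bsub>G\<^esub> x) = derived_mult (H, C) #>\<^bsub>H\<^esub> f x"
    if "x \<in> carrier G" for x
    using that by (rule ab_quot_map_coset)
next
  fix G H :: "'a monoid" and B C f
  assume *: "(G, B) \<in> Obj NQP" "(H, C) \<in> Obj NQP" "f \<in> Mor NQP (G, B) (H, C)"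
  then interpret quadratic_pair_map G H B C f
    by (intro QP_mor_imp) (simp_all add: NQP_simps)
  show "quot_map G B H C f (B #>\<^bsub>G\<^esub> x) = C #>\<^bsub>H\<^esub> f x" if "x \<in> carrier G" for x
    using * that by (intro quot_map_coset hom_modulo_pair) (simp_all add: NQP_simps)
next
  fix G H :: "'a monoid" and B C f
  assume *: "(G, B) \<in> Obj AQP" "(H, C) \<in> Obj AQP" "f \<in> Mor AQP (G, B) (H, C)"
  then interpret quadratic_pair_map G H B C f
    by (intro QP_mor_imp) (simp_all add: AQP_simps)
  have C: "comm_group (H\<lparr>carrier := C\<rparr>)" using * by (simp add: AQP_simps)
  show "w_map (G, B) H f \<in> carrier (fobj Dbifun ((G, B), (H, C)))"
    using w_map_in_ext_hom[OF C] by (simp add: fobj_Dbifun carrier_hom_group)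
  show "w_map (G, B) H f (class_tensor (G, B) a b) = dev G H f a b"
    if "a \<in> carrier G" "b \<in> carrier G" for a b
    using that by (rule w_map_class_tensor[OF C])
next
  fix K G H :: "'a monoid" and A B C g f
  assume *: "(K, A) \<in> Obj AQP" "(G, B) \<in> Obj AQP" "(H, C) \<in> Obj AQP"
    "g \<in> Mor AQP (K, A) (G, B)" "f \<in> Mor AQP (G, B) (H, C)"
  then interpret quadratic_pair_map_compose K G H A B C g f
    by (intro QP_mor_compose) (simp_all add: AQP_simps)
  show "w_map (K, A) H (Comp AQP (K, A) (G, B) (H, C) f g)
      = fmor Dbifun ((K, A), (G, B)) ((K, A), (H, C)) (Ident AQP (K, A), f) (w_map (K, A) G g)
        \<otimes>\<^bsub>fobj Dbifun ((K, A), (H, C))\<^esub>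
        fmor Dbifun ((G, B), (H, C)) ((K, A), (H, C)) (g, Ident AQP (H, C)) (w_map (G, B) H f)"
    using * w_map_derivation by (simp add: AQP_simps Comp_QP Ident_QP fobj_Dbifun)
qed

end
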